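(* If a rule set $\mathcal{R}$ is deterministic restricted prefix-cyclic (DRPC), it never-terminates.
   Context: Setting (restricted disjunctive chase). Rules $\rho$: $\forall \vec w,\vec x.[\beta\to \bigvee_{i=1}^n \exists \vec y_i.\eta_i]$ with frontier $\vec x$, $\mathrm{branching}(\rho)=n$; $\rho$ is deterministic if $n=1$, datalog if deterministic without existential variables; skolemization $\mathrm{sk}(\rho)$ replaces $y\in\vec y_i$ by $f^\rho_{i,y}(\vec x)$. Trigger $\lambda=(\rho,\sigma)$ (deterministic if $\rho$ is): loaded for $F$ if $\mathrm{body}(\rho)\sigma\subseteq F$; obsolete for $F$ if some extension $\sigma'$ of $\sigma$ gives $\mathrm{head}_i(\rho)\sigma'\subseteq F$; $\mathrm{out}_i(\lambda)=\mathrm{head}_i(\mathrm{sk}(\rho))\sigma$; $\mathcal{R}$-triggers use rules of $\mathcal{R}$ and substitutions into terms over $\mathrm{sk}(\mathcal{R})$. Chase trees of $(\mathcal{R},D)$ are rooted at $D$, apply loaded non-obsolete $\mathcal{R}$-triggers (datalog first) with one child per disjunct, leaves satisfy all rules, fairness holds; $\mathcal{R}$ never-terminates if some KB with $\mathcal{R}$ has no finite chase tree. Birth facts: $\mathrm{birth}(c)=\emptyset$; $\mathrm{birth}(f^\psi_{i,v}(\vec s))=\mathrm{out}_i((\psi,\tau))\cup\bigcup_s\mathrm{birth}(s)$ with $\tau$ mapping $\mathrm{frontier}(\psi)$ to $\vec s$; $\mathrm{birth}((\psi,\tau))=\bigcup_{x\in\mathrm{frontier}(\psi)}\mathrm{birth}(\tau(x))$;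 $\mathrm{skel}(\lambda)$ = terms of $\mathrm{birth}(\lambda)$ plus constants assigned to frontier variables. $h^\star_\lambda$ maps terms of $\mathrm{skel}(\lambda)$ to themselves and all others to a special constant $\star$. $\mathcal{O}(\mathcal{R},\lambda,h)$ is the minimal fact set containing all facts over predicates of $\mathcal{R}$ and constants in $\mathrm{skel}(\lambda)\cup\{\star\}$, including $\mathrm{birth}(\lambda)$, and including $h(\bigcup_i\mathrm{out}_i(\lambda'))$ for every $\mathcal{R}$-trigger $\lambda'=(\psi,\tau)$ loaded for it such that if $\psi=\rho$ then $\mathrm{out}_i(\lambda')\neq\mathrm{out}_i(\lambda)$ for some $i$. $\lambda$ is $\star$-unblockable for $\mathcal{R}$ if its rule is datalog or it is not obsolete for $\mathcal{O}(\mathcal{R},\lambda,h^\star_\lambda)$. $D_\rho=\mathrm{body}(\rho)\sigma_{uc}$ with $\sigma_{uc}$ mapping each variable $x$ to a fresh constant $c_x$. A term is cyclic if it has a subterm $f(\vec s)$ with $f$ occurring in $\vec s$; $\rho$-cyclic if it is $f(\vec s)$ with $f$ from $\mathrm{sk}(\rho)$ occurring in $\vec s$. For a deterministic $\rho\in\mathcal{R}$, $\mathrm{DRPC}(\mathcal{R},\rho)$ is the (least) fact set including $D_\rho$, $\mathrm{out}_1((\rho,\sigma_{uc}))$, and $\mathrm{out}_1(\lambda)$ for every deterministic $\mathcal{R}$-trigger $\lambda=(\psi,\tau)$ with no cyclic term in the range of $\tau$, loaded for $\mathrm{DRPC}(\mathcal{R},\rho)$, $\star$-unblockable for $\mathcal{R}$,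 and with $\tau$ injective if $\psi=\rho$. $\mathcal{R}$ is DRPC if there is a deterministic (generating) $\rho\in\mathcal{R}$ and a $\rho$-cyclic term occurring in $\mathrm{DRPC}(\mathcal{R},\rho)$. *)

theory Defs
  imports Main
begin

section \<open>Rules, terms and facts\<close>

type_synonym var = nat

datatype pred = Pred (pred_name: nat) (arity: nat)

datatype 'a atom = Atom (pred_of: pred) (args: "'a list")

abbreviation wf_atom :: "'a atom \<Rightarrow> bool" where
  "wf_atom A \<equiv> length (args A) = arity (pred_of A)"

text \<open>
  A rule is free of constants and functions, and it is determined by its body and the list of its
  head disjuncts: the variables of the body are the universally quantified ones, all other
  variables of a disjunct are existentially quantified in it. Disjuncts are numbered from 0.
\<close>

datatype rule = Rule (body: "var atom list") (heads: "var atom list list")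

definition branching :: "rule \<Rightarrow> nat" where
  "branching \<rho> = length (heads \<rho>)"

definition head :: "nat \<Rightarrow> rule \<Rightarrow> var atom list" where
  "head i \<rho> = heads \<rho> ! i"

definition wf_rule :: "rule \<Rightarrow> bool" where
  "wf_rule \<rho> \<longleftrightarrow> branching \<rho> \<ge> 1 \<and>
     (\<forall>A\<in>set (body \<rho>). wf_atom A) \<and> (\<forall>\<eta>\<in>set (heads \<rho>). \<forall>A\<in>set \<eta>. wf_atom A)"

definition atoms_vars :: "var atom list \<Rightarrow> var list" where
  "atoms_vars As = concat (map args As)"

definition body_vars :: "rule \<Rightarrow> var set" where
  "body_vars \<rho> = set (atoms_vars (body \<rho>))"

text \<open>A list, since it provides the ordered arguments of the Skolem functions.\<close>

definition frontier :: "rule \<Rightarrow> var list" where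
  "frontier \<rho> =
     remdups (filter (\<lambda>x. \<exists>\<eta>\<in>set (heads \<rho>). x \<in> set (atoms_vars \<eta>)) (atoms_vars (body \<rho>)))"

definition ex_vars :: "nat \<Rightarrow> rule \<Rightarrow> var set" where
  "ex_vars i \<rho> = set (atoms_vars (head i \<rho>)) - body_vars \<rho>"

definition deterministic :: "rule \<Rightarrow> bool" where
  "deterministic \<rho> \<longleftrightarrow> branching \<rho> = 1"

definition generating :: "rule \<Rightarrow> bool" where
  "generating \<rho> \<longleftrightarrow> (\<exists>i<branching \<rho>. ex_vars i \<rho> \<noteq> {})"

definition datalog :: "rule \<Rightarrow> bool" where
  "datalog \<rho> \<longleftrightarrow> deterministic \<rho> \<and> \<not> generating \<rho>"

definition preds :: "rule set \<Rightarrow> pred set" where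
  "preds R = (\<Union>\<rho>\<in>R. pred_of ` (set (body \<rho>) \<union> (\<Union>\<eta>\<in>set (heads \<rho>). set \<eta>)))"

text \<open>\<open>Sk \<rho> i y\<close> is the Skolem function symbol of the existential variable \<open>y\<close> in disjunct \<open>i\<close> of \<open>\<rho>\<close>.\<close>

datatype fsym = Sk rule nat var

text \<open>
  \<open>Cst\<close> are the ordinary constants, \<open>VarCst x\<close> is the fresh constant of the variable \<open>x\<close>, and
  \<open>Star\<close> is the special constant. The basic symbols of a term are variables (in Skolemized rules,
  which are constant-free) or constants (in ground terms).
\<close>

datatype const = Cst nat | VarCst var | Star

datatype 'a trm = Base 'a | Fn fsym "'a trm list"

type_synonym gterm = "const trm"
type_synonym fact = "gterm atom"
type_synonym subst = "var \<Rightarrow> gterm"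

primrec subst_trm :: "subst \<Rightarrow> var trm \<Rightarrow> gterm" where
  "subst_trm \<sigma> (Base x) = \<sigma> x"
| "subst_trm \<sigma> (Fn f ts) = Fn f (map (subst_trm \<sigma>) ts)"

primrec subterms :: "'a trm \<Rightarrow> 'a trm set" where
  "subterms (Base a) = {Base a}"
| "subterms (Fn f ts) = insert (Fn f ts) (\<Union> (set (map subterms ts)))"

primrec funs :: "'a trm \<Rightarrow> fsym set" where
  "funs (Base a) = {}"
| "funs (Fn f ts) = insert f (\<Union> (set (map funs ts)))"

definition terms_of :: "fact set \<Rightarrow> gterm set" where
  "terms_of F = (\<Union>A\<in>F. \<Union>t\<in>set (args A). subterms t)"

definition sk_trm :: "nat \<Rightarrow> rule \<Rightarrow> var \<Rightarrow> var trm" where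
  "sk_trm i \<rho> v =
     (if v \<in> ex_vars i \<rho> then Fn (Sk \<rho> i v) (map Base (frontier \<rho>)) else Base v)"

definition sk_head :: "nat \<Rightarrow> rule \<Rightarrow> var trm atom list" where
  "sk_head i \<rho> = map (map_atom (sk_trm i \<rho>)) (head i \<rho>)"

definition sk_funs :: "rule \<Rightarrow> fsym set" where
  "sk_funs \<rho> = {Sk \<rho> i y | i y. i < branching \<rho> \<and> y \<in> ex_vars i \<rho>}"

inductive_set sk_terms :: "rule set \<Rightarrow> gterm set" for R where
  "Base c \<in> sk_terms R"
| "\<rho> \<in> R \<Longrightarrow> Sk \<rho> i y \<in> sk_funs \<rho> \<Longrightarrow> length ts = length (frontier \<rho>) \<Longrightarrow>
    \<forall>t\<in>set ts. t \<in> sk_terms R \<Longrightarrow> Fn (Sk \<rho> i y) ts \<in> sk_terms R"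


section \<open>Triggers\<close>

text \<open>
  Substitutions are total functions; only their values on the body variables of the rule matter.
\<close>

type_synonym trigger = "rule \<times> subst"

definition out :: "nat \<Rightarrow> trigger \<Rightarrow> fact set" where
  "out i = (\<lambda>(\<rho>, \<sigma>). map_atom (subst_trm \<sigma>) ` set (sk_head i \<rho>))"

definition loaded :: "fact set \<Rightarrow> trigger \<Rightarrow> bool" where
  "loaded F = (\<lambda>(\<rho>, \<sigma>). map_atom \<sigma> ` set (body \<rho>) \<subseteq> F)"

definition obsolete :: "fact set \<Rightarrow> trigger \<Rightarrow> bool" where
  "obsolete F = (\<lambda>(\<rho>, \<sigma>). \<exists>i<branching \<rho>. \<exists>\<sigma>'.
     (\<forall>x\<in>body_vars \<rho>. \<sigma>' x = \<sigma> x) \<and> map_atom \<sigma>' ` set (head i \<rho>) \<subseteq> F)"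

definition is_trigger :: "rule set \<Rightarrow> trigger \<Rightarrow> bool" where
  "is_trigger R = (\<lambda>(\<rho>, \<sigma>). \<rho> \<in> R \<and> \<sigma> ` body_vars \<rho> \<subseteq> sk_terms R)"

definition satisfies :: "fact set \<Rightarrow> rule \<Rightarrow> bool" where
  "satisfies F \<rho> \<longleftrightarrow> (\<forall>\<sigma>. loaded F (\<rho>, \<sigma>) \<longrightarrow> obsolete F (\<rho>, \<sigma>))"

lemma loaded_mono [mono]:
  "(\<And>A. P A \<longrightarrow> Q A) \<Longrightarrow> loaded {A. P A} \<mu> \<longrightarrow> loaded {A. Q A} \<mu>"
  by (auto simp: loaded_def split: prod.splits)


section \<open>The restricted disjunctive chase\<close>

definition database :: "fact set \<Rightarrow> bool" where
  "database D \<longleftrightarrow> finite D \<and> (\<forall>A\<in>D. wf_atom A \<and> set (args A) \<subseteq> range Base)"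

text \<open>
  The vertices of a chase tree are addresses: \<open>[]\<close> is the root and \<open>v @ [i]\<close> is the child of \<open>v\<close>
  for disjunct \<open>i\<close>. The vertices are labelled with fact sets by \<open>fct\<close>, and the non-leaf
  vertices with triggers by \<open>trg\<close>.
\<close>

definition is_leaf :: "nat list set \<Rightarrow> nat list \<Rightarrow> bool" where
  "is_leaf V v \<longleftrightarrow> v \<in> V \<and> (\<forall>i. v @ [i] \<notin> V)"

definition chase_tree ::
  "rule set \<Rightarrow> fact set \<Rightarrow> nat list set \<Rightarrow> (nat list \<Rightarrow> fact set) \<Rightarrow> (nat list \<Rightarrow> trigger) \<Rightarrow> bool"
where
  "chase_tree R D V fct trg \<longleftrightarrow>
     [] \<in> V \<and> (\<forall>v i. v @ [i] \<in> V \<longrightarrow> v \<in> V) \<and> fct [] = D \<and>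
     (\<forall>v\<in>V. \<not> is_leaf V v \<longrightarrow>
        is_trigger R (trg v) \<and> loaded (fct v) (trg v) \<and> \<not> obsolete (fct v) (trg v) \<and>
        (\<not> datalog (fst (trg v)) \<longrightarrow> (\<forall>\<psi>\<in>R. datalog \<psi> \<longrightarrow> satisfies (fct v) \<psi>)) \<and>
        (\<forall>i. v @ [i] \<in> V \<longleftrightarrow> i < branching (fst (trg v))) \<and>
        (\<forall>i<branching (fst (trg v)). fct (v @ [i]) = fct v \<union> out i (trg v))) \<and>
     (\<forall>v. is_leaf V v \<longrightarrow> (\<forall>\<rho>\<in>R. satisfies (fct v) \<rho>)) \<and>
     (\<forall>v\<in>V. \<forall>\<mu>. is_trigger R \<mu> \<and> loaded (fct v) \<mu> \<longrightarrow>
        (\<exists>k. \<forall>w. length w = k \<and> v @ w \<in> V \<longrightarrow> obsolete (fct (v @ w)) \<mu>))"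

definition never_terminates :: "rule set \<Rightarrow> bool" where
  "never_terminates R \<longleftrightarrow>
     (\<exists>D. database D \<and> \<not> (\<exists>V fct trg. chase_tree R D V fct trg \<and> finite V))"


section \<open>Unblockability\<close>

fun birth_term :: "gterm \<Rightarrow> fact set" where
  "birth_term (Base c) = {}"
| "birth_term (Fn (Sk \<psi> i v) ss) =
     out i (\<psi>, \<lambda>x. the (map_of (zip (frontier \<psi>) ss) x)) \<union> (\<Union>s\<in>set ss. birth_term s)"

definition birth :: "trigger \<Rightarrow> fact set" where
  "birth = (\<lambda>(\<rho>, \<sigma>). \<Union>x\<in>set (frontier \<rho>). birth_term (\<sigma> x))"

definition skel :: "trigger \<Rightarrow> gterm set" where
  "skel = (\<lambda>(\<rho>, \<sigma>). terms_of (birth (\<rho>, \<sigma>)) \<union> (\<sigma> ` set (frontier \<rho>) \<inter> range Base))"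

definition h_star :: "trigger \<Rightarrow> gterm \<Rightarrow> gterm" where
  "h_star \<mu> t = (if t \<in> skel \<mu> then t else Base Star)"

inductive_set overapprox :: "rule set \<Rightarrow> trigger \<Rightarrow> (gterm \<Rightarrow> gterm) \<Rightarrow> fact set" for R \<mu> h where
  constants: "p \<in> preds R \<Longrightarrow> length ts = arity p \<Longrightarrow>
    set ts \<subseteq> insert (Base Star) (skel \<mu> \<inter> range Base) \<Longrightarrow> Atom p ts \<in> overapprox R \<mu> h"
| birth: "A \<in> birth \<mu> \<Longrightarrow> A \<in> overapprox R \<mu> h"
| step: "is_trigger R (\<psi>, \<tau>) \<Longrightarrow> loaded (overapprox R \<mu> h) (\<psi>, \<tau>) \<Longrightarrow>
    (\<psi> = fst \<mu> \<longrightarrow> (\<exists>j<branching \<psi>. out j (\<psi>, \<tau>) \<noteq> out j \<mu>)) \<Longrightarrow>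
    i < branching \<psi> \<Longrightarrow> A \<in> out i (\<psi>, \<tau>) \<Longrightarrow> map_atom h A \<in> overapprox R \<mu> h"

definition star_unblockable :: "rule set \<Rightarrow> trigger \<Rightarrow> bool" where
  "star_unblockable R \<mu> \<longleftrightarrow>
     datalog (fst \<mu>) \<or> \<not> obsolete (overapprox R \<mu> (h_star \<mu>)) \<mu>"


section \<open>Deterministic restricted prefix-cyclicity\<close>

definition cyclic :: "gterm \<Rightarrow> bool" where
  "cyclic t \<longleftrightarrow> (\<exists>f ss. Fn f ss \<in> subterms t \<and> (\<exists>s\<in>set ss. f \<in> funs s))"

definition rule_cyclic :: "rule \<Rightarrow> gterm \<Rightarrow> bool" where
  "rule_cyclic \<rho> t \<longleftrightarrow> (\<exists>f ss. t = Fn f ss \<and> f \<in> sk_funs \<rho> \<and> (\<exists>s\<in>set ss. f \<in> funs s))"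

definition \<sigma>_uc :: subst where
  "\<sigma>_uc x = Base (VarCst x)"

definition rule_db :: "rule \<Rightarrow> fact set" where
  "rule_db \<rho> = map_atom \<sigma>_uc ` set (body \<rho>)"

text \<open>The only disjunct of a deterministic rule is number 0.\<close>

inductive_set DRPC_facts :: "rule set \<Rightarrow> rule \<Rightarrow> fact set" for R \<rho> where
  db: "A \<in> rule_db \<rho> \<Longrightarrow> A \<in> DRPC_facts R \<rho>"
| start: "A \<in> out 0 (\<rho>, \<sigma>_uc) \<Longrightarrow> A \<in> DRPC_facts R \<rho>"
| step: "is_trigger R (\<psi>, \<tau>) \<Longrightarrow> deterministic \<psi> \<Longrightarrow> \<forall>x\<in>body_vars \<psi>. \<not> cyclic (\<tau> x) \<Longrightarrow>
    loaded (DRPC_facts R \<rho>) (\<psi>, \<tau>) \<Longrightarrow> star_unblockable R (\<psi>, \<tau>) \<Longrightarrow>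
    (\<psi> = \<rho> \<longrightarrow> inj_on \<tau> (body_vars \<psi>)) \<Longrightarrow>
    A \<in> out 0 (\<psi>, \<tau>) \<Longrightarrow> A \<in> DRPC_facts R \<rho>"

definition DRPC :: "rule set \<Rightarrow> bool" where
  "DRPC R \<longleftrightarrow>
     (\<exists>\<rho>\<in>R. deterministic \<rho> \<and> generating \<rho> \<and> (\<exists>t\<in>terms_of (DRPC_facts R \<rho>). rule_cyclic \<rho> t))"

end

theory Submission
  imports Defs
begin

text \<open>
  Let \<open>c\<close> be the frontier of \<open>\<rho>\<close> under \<open>\<sigma>_uc\<close>. A generating trigger whose frontier is
  mapped to constants is never \<open>\<star>\<close>-unblockable, because the critical facts over its skeleton and
  \<open>\<star>\<close> make it obsolete. Hence before \<open>\<rho>\<close> is applied a second time in the construction of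
  \<open>DRPC_facts\<close>, every functional term contains a start term \<open>f\<^sub>y(c)\<close> and has exactly one level
  of Skolem functions of \<open>\<rho>\<close>. A cyclic term therefore comes with a second \<open>\<rho>\<close>-trigger \<open>\<tau>\<close>,
  loaded for these facts, at least one of whose frontier terms is functional. Iterating the constant
  mapping \<open>c\<^sub>x \<mapsto> \<tau>(x)\<close> produces copies of the facts with ever deeper terms.

  In a model derived by the chase, all these copies occur: if the image of an unblockable trigger
  \<open>\<mu>\<close> did not fire, then pulling terms back along the mapping, with \<open>\<star>\<close> for those that are not in
  the image of the skeleton of \<open>\<mu>\<close>, would embed the model into the overapproximation of \<open>\<mu>\<close> and
  so carry the obsoleteness of the image back to \<open>\<mu>\<close>. Counting levels of Skolem functions of
  \<open>\<rho>\<close> shows that the pull-back is well defined.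

  The start trigger \<open>(\<rho>, \<sigma>_uc)\<close> is not unblockable, so over the database \<open>D\<^sub>\<rho>\<close> it might never
  be applied. The database used instead is \<open>D\<^sub>\<rho>\<close> together with the head of \<open>\<rho>\<close> in which each
  existential variable \<open>y\<close> is a fresh constant. There the start trigger stays obsolete, so
  \<open>f\<^sub>y(c)\<close> is never created, and renaming the fresh constants to \<open>f\<^sub>y(c)\<close> is injective.
\<close>

section \<open>Terms, outputs and triggers\<close>

lemma head_var_cases:
  assumes "i < branching \<psi>" "A \<in> set (head i \<psi>)" "v \<in> set (args A)"
  shows "v \<in> ex_vars i \<psi> \<or> v \<in> set (frontier \<psi>)"
  using assms unfolding ex_vars_def frontier_def body_vars_def branching_def head_def atoms_vars_def
  by auto

lemma frontier_body: "x \<in> set (frontier \<psi>) \<Longrightarrow> x \<in> body_vars \<psi>"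
  by (auto simp: frontier_def body_vars_def)

lemma frontier_not_ex: "x \<in> set (frontier \<psi>) \<Longrightarrow> x \<notin> ex_vars i \<psi>"
  by (auto simp: ex_vars_def dest: frontier_body)

lemma ex_var_in_head:
  "v \<in> ex_vars i \<psi> \<Longrightarrow> \<exists>A\<in>set (head i \<psi>). v \<in> set (args A)"
  by (auto simp: ex_vars_def atoms_vars_def)

lemma body_var_in_body:
  "x \<in> body_vars \<psi> \<Longrightarrow> \<exists>A\<in>set (body \<psi>). x \<in> set (args A)"
  by (auto simp: body_vars_def atoms_vars_def)

lemma body_varsI: "A \<in> set (body \<psi>) \<Longrightarrow> x \<in> set (args A) \<Longrightarrow> x \<in> body_vars \<psi>"
  by (auto simp: body_vars_def atoms_vars_def)

lemma map_atom_cong: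
  "(\<And>x. x \<in> set (args A) \<Longrightarrow> f x = g x) \<Longrightarrow> map_atom f A = map_atom g A"
  by (cases A) auto

lemma map_atom_map_atom: "map_atom f (map_atom g A) = map_atom (\<lambda>x. f (g x)) A"
  by (cases A) auto

lemma image_map_atom_cong:
  "(\<And>A x. A \<in> \<A> \<Longrightarrow> x \<in> set (args A) \<Longrightarrow> f x = g x) \<Longrightarrow> map_atom f ` \<A> = map_atom g ` \<A>"
  by (rule image_cong) (auto intro: map_atom_cong)

section \<open>Subterms and the terms of fact sets\<close>

lemma subterms_refl [simp]: "t \<in> subterms t"
  by (cases t) auto

lemma subterms_arg: "t \<in> set ts \<Longrightarrow> t \<in> subterms (Fn f ts)"
  by (auto intro!: bexI[of _ t])

lemma subterms_trans: "s \<in> subterms t \<Longrightarrow> t \<in> subterms u \<Longrightarrow> s \<in> subterms u"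
  by (induction u) auto

lemma terms_of_subterm: "t \<in> terms_of F \<Longrightarrow> s \<in> subterms t \<Longrightarrow> s \<in> terms_of F"
  by (auto simp: terms_of_def intro: subterms_trans)

lemma terms_of_arg: "Fn f ts \<in> terms_of F \<Longrightarrow> t \<in> set ts \<Longrightarrow> t \<in> terms_of F"
  by (blast intro: terms_of_subterm subterms_arg)

lemma args_in_terms_of: "A \<in> F \<Longrightarrow> t \<in> set (args A) \<Longrightarrow> t \<in> terms_of F"
  by (auto simp: terms_of_def intro!: bexI)

lemma terms_of_mono: "F \<subseteq> G \<Longrightarrow> terms_of F \<subseteq> terms_of G"
  by (auto simp: terms_of_def)

lemma loaded_terms:
  assumes "loaded F (\<psi>, \<tau>)" "x \<in> body_vars \<psi>"
  shows "\<tau> x \<in> terms_of F"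
proof -
  obtain A where A: "A \<in> set (body \<psi>)" "x \<in> set (args A)"
    using body_var_in_body[OF assms(2)] by blast
  have "map_atom \<tau> A \<in> F" using assms(1) A by (auto simp: loaded_def)
  moreover have "\<tau> x \<in> set (args (map_atom \<tau> A))" using A by (simp add: atom.map_sel)
  ultimately show ?thesis by (rule args_in_terms_of)
qed

text \<open>Composes Skolemization with instantiation, so that an output becomes a direct image of
  the unskolemized head.\<close>

definition sk_val :: "nat \<Rightarrow> rule \<Rightarrow> subst \<Rightarrow> subst" where
  "sk_val i \<psi> \<tau> v =
     (if v \<in> ex_vars i \<psi> then Fn (Sk \<psi> i v) (map \<tau> (frontier \<psi>)) else \<tau> v)"

lemma sk_val_ex: "v \<in> ex_vars i \<psi> \<Longrightarrow> sk_val i \<psi> \<tau> v = Fn (Sk \<psi> i v) (map \<tau> (frontier \<psi>))"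
  by (simp add: sk_val_def)

lemma sk_val_frontier: "v \<in> set (frontier \<psi>) \<Longrightarrow> sk_val i \<psi> \<tau> v = \<tau> v"
  by (simp add: sk_val_def frontier_not_ex)

lemma out_eq: "out i (\<psi>, \<tau>) = map_atom (sk_val i \<psi> \<tau>) ` set (head i \<psi>)"
proof -
  have "(\<lambda>v. subst_trm \<tau> (sk_trm i \<psi> v)) = sk_val i \<psi> \<tau>"
    by (auto simp: sk_trm_def sk_val_def fun_eq_iff comp_def)
  then show ?thesis
    by (auto simp: out_def sk_head_def image_image map_atom_map_atom)
qed

lemma finite_out: "finite (out i \<mu>)"
  by (cases \<mu>) (simp add: out_eq)

lemma out_cong:
  assumes "i < branching \<psi>" "\<And>x. x \<in> set (frontier \<psi>) \<Longrightarrow> \<sigma> x = \<tau> x"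
  shows "out i (\<psi>, \<sigma>) = out i (\<psi>, \<tau>)"
  unfolding out_eq
proof (rule image_map_atom_cong)
  fix A v assume "A \<in> set (head i \<psi>)" "v \<in> set (args A)"
  then have "v \<in> ex_vars i \<psi> \<or> v \<in> set (frontier \<psi>)" by (rule head_var_cases[OF assms(1)])
  then show "sk_val i \<psi> \<sigma> v = sk_val i \<psi> \<tau> v"
    using assms(2) by (auto simp: sk_val_ex sk_val_frontier)
qed

lemma out_args_cases:
  assumes "i < branching \<psi>" "A \<in> out i (\<psi>, \<tau>)" "t \<in> set (args A)"
  obtains (Ex) v where "v \<in> ex_vars i \<psi>" "t = Fn (Sk \<psi> i v) (map \<tau> (frontier \<psi>))"
  | (Frontier) x where "x \<in> set (frontier \<psi>)" "t = \<tau> x"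
proof -
  obtain B where B: "B \<in> set (head i \<psi>)" "A = map_atom (sk_val i \<psi> \<tau>) B"
    using assms(2) by (auto simp: out_eq)
  obtain v where v: "v \<in> set (args B)" "t = sk_val i \<psi> \<tau> v"
    using assms(3) B by (auto simp: atom.map_sel)
  show thesis using head_var_cases[OF assms(1) B(1) v(1)] v(2) Ex Frontier
    by (auto simp: sk_val_ex sk_val_frontier)
qed

lemma out_ex_term:
  assumes "v \<in> ex_vars i \<psi>"
  shows "\<exists>A\<in>out i (\<psi>, \<tau>). Fn (Sk \<psi> i v) (map \<tau> (frontier \<psi>)) \<in> set (args A)"
proof -
  obtain B where B: "B \<in> set (head i \<psi>)" "v \<in> set (args B)"
    using ex_var_in_head[OF assms] by blast
  then show ?thesis
    using assms by (auto simp: out_eq atom.map_sel sk_val_ex intro!: bexI[of _ B] image_eqI[of _ _ v])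
qed

lemma size_arg: "t \<in> set ts \<Longrightarrow> size t < size (Fn f ts)"
  by (induction ts) auto

text \<open>The new Skolem term has the frontier values as arguments. These could differ only if the
  new term of each trigger were a frontier value of the other one, and then two terms would be
  strictly smaller than each other.\<close>

lemma out_inj:
  assumes "i < branching \<psi>" "y \<in> ex_vars i \<psi>" "out i (\<psi>, \<sigma>) = out i (\<psi>, \<tau>)"
    and "x \<in> set (frontier \<psi>)"
  shows "\<sigma> x = \<tau> x"
proof -
  let ?f = "Sk \<psi> i y" and ?fr = "frontier \<psi>"
  have *: "map \<sigma> ?fr = map \<tau> ?fr \<or> (\<exists>v\<in>set ?fr. \<tau> v = Fn ?f (map \<sigma> ?fr))"
    if "out i (\<psi>, \<sigma>) = out i (\<psi>, \<tau>)" for \<sigma> \<tau>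
  proof -
    obtain A where "A \<in> out i (\<psi>, \<tau>)" "Fn ?f (map \<sigma> ?fr) \<in> set (args A)"
      using out_ex_term[OF assms(2), of \<sigma>] \<open>out i (\<psi>, \<sigma>) = out i (\<psi>, \<tau>)\<close> by auto
    then show ?thesis by (cases rule: out_args_cases[OF assms(1)]) auto
  qed
  have "map \<sigma> ?fr = map \<tau> ?fr"
  proof (rule ccontr)
    assume n: "map \<sigma> ?fr \<noteq> map \<tau> ?fr"
    then obtain v w where v: "v \<in> set ?fr" "\<tau> v = Fn ?f (map \<sigma> ?fr)"
      and w: "w \<in> set ?fr" "\<sigma> w = Fn ?f (map \<tau> ?fr)"
      using *[OF assms(3)] *[OF assms(3)[symmetric]] by metis
    have "size (\<sigma> w) < size (\<tau> v)" unfolding v(2) using w(1) by (intro size_arg) auto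
    moreover have "size (\<tau> v) < size (\<sigma> w)" unfolding w(2) using v(1) by (intro size_arg) auto
    ultimately show False by simp
  qed
  then show ?thesis using assms(4) by simp
qed

section \<open>Maps that commute with function symbols and may send constants to any terms\<close>

definition hom :: "(gterm \<Rightarrow> gterm) \<Rightarrow> bool" where
  "hom \<gamma> \<longleftrightarrow> (\<forall>f ts. \<gamma> (Fn f ts) = Fn f (map \<gamma> ts))"

lemma hom_funpow: "hom \<gamma> \<Longrightarrow> hom (\<gamma> ^^ n)"
  by (induction n) (auto simp: hom_def)

lemma hom_out:
  assumes "hom \<gamma>"
  shows "map_atom \<gamma> ` out i (\<psi>, \<tau>) = out i (\<psi>, \<lambda>x. \<gamma> (\<tau> x))"
  unfolding out_eq image_image map_atom_map_atom
  using assms by (intro image_map_atom_cong) (auto simp: hom_def sk_val_def)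

lemma hom_subterm: "hom \<gamma> \<Longrightarrow> s \<in> subterms t \<Longrightarrow> \<gamma> s \<in> subterms (\<gamma> t)"
  by (induction t) (auto simp: hom_def)

text \<open>The largest number of symbols from \<open>X\<close> on a path from the root to a leaf;
  used with the Skolem functions of \<rho>.\<close>

primrec rank :: "fsym set \<Rightarrow> gterm \<Rightarrow> nat" where
  "rank X (Base a) = 0"
| "rank X (Fn f ts) = of_bool (f \<in> X) + foldr max (map (rank X) ts) 0"

lemma foldr_max_le_iff: "foldr max xs 0 \<le> n \<longleftrightarrow> (\<forall>x\<in>set xs. x \<le> (n::nat))"
  by (induction xs) auto

lemma rank_arg: "t \<in> set ts \<Longrightarrow> of_bool (f \<in> X) + rank X t \<le> rank X (Fn f ts)"
  using foldr_max_le_iff[of "map (rank X) ts" "foldr max (map (rank X) ts) 0"] by auto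

lemma rank_le: "(\<And>t. t \<in> set ts \<Longrightarrow> rank X t \<le> n) \<Longrightarrow> rank X (Fn f ts) \<le> of_bool (f \<in> X) + n"
  using foldr_max_le_iff[of "map (rank X) ts" n] by auto

lemma rank_subterm: "s \<in> subterms t \<Longrightarrow> rank X s \<le> rank X t"
proof (induction t)
  case (Fn f ts)
  then consider "s = Fn f ts" | t where "t \<in> set ts" "s \<in> subterms t" by auto
  then show ?case
  proof cases
    case 2
    then show ?thesis using Fn.IH[OF 2] rank_arg[OF 2(1), of f X] by linarith
  qed simp
qed simp

lemma rank_funs: "f \<in> funs t \<Longrightarrow> f \<in> X \<Longrightarrow> 1 \<le> rank X t"
proof (induction t)
  case (Fn g ts)
  show ?case
  proof (cases "f = g")
    case False
    then obtain t where t: "t \<in> set ts" "f \<in> funs t" using Fn.prems by auto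
    then show ?thesis using Fn.IH[OF t Fn.prems(2)] rank_arg[OF t(1), of g X] by linarith
  qed (use Fn.prems in simp)
qed simp

text \<open>A path in the image runs through \<open>t\<close> and then possibly through the image of
  a constant, so the two contributions add up.\<close>

lemma rank_hom_le:
  assumes "hom \<gamma>" "\<And>c. Base c \<in> subterms t \<Longrightarrow> rank X (\<gamma> (Base c)) \<le> n"
  shows "rank X (\<gamma> t) \<le> rank X t + n"
  using assms(2)
proof (induction t)
  case (Fn f ts)
  let ?m = "foldr max (map (rank X) ts) 0"
  have "rank X (Fn f (map \<gamma> ts)) \<le> of_bool (f \<in> X) + (?m + n)"
  proof (rule rank_le)
    fix s assume "s \<in> set (map \<gamma> ts)"
    then obtain t where t: "t \<in> set ts" "s = \<gamma> t" by auto
    have "rank X (\<gamma> t) \<le> rank X t + n" using t Fn by auto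
    moreover have "rank X t \<le> ?m" using t(1) foldr_max_le_iff[of "map (rank X) ts" ?m] by auto
    ultimately show "rank X s \<le> ?m + n" using t by simp
  qed
  then show ?case using assms(1) by (simp add: hom_def)
qed simp

text \<open>Keeps of a chase branch only that loaded triggers are applied, which is all that the
  pull-back uses. The start trigger can thus serve as a first step over
  \<open>rule_db \<rho>\<close>.\<close>

inductive deriv :: "rule set \<Rightarrow> fact set \<Rightarrow> fact set \<Rightarrow> bool" for R D where
  init: "deriv R D D"
| step: "deriv R D F \<Longrightarrow> is_trigger R (\<psi>, \<tau>) \<Longrightarrow> loaded F (\<psi>, \<tau>) \<Longrightarrow> i < branching \<psi> \<Longrightarrow>
    deriv R D (F \<union> out i (\<psi>, \<tau>))"

lemma deriv_subset: "deriv R D F \<Longrightarrow> D \<subseteq> F"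
  by (induction rule: deriv.induct) auto

lemma head_in_preds:
  assumes "\<psi> \<in> R" "i < branching \<psi>" "A \<in> set (head i \<psi>)"
  shows "pred_of A \<in> preds R"
proof -
  have "head i \<psi> \<in> set (heads \<psi>)" using assms(2) by (auto simp: head_def branching_def)
  then show ?thesis using assms by (auto simp: preds_def intro!: bexI[of _ \<psi>])
qed

lemma head_wf:
  assumes "wf_rule \<psi>" "i < branching \<psi>" "A \<in> set (head i \<psi>)"
  shows "wf_atom A"
proof -
  have "head i \<psi> \<in> set (heads \<psi>)" using assms(2) by (auto simp: head_def branching_def)
  then show ?thesis using assms by (auto simp: wf_rule_def)
qed

lemma body_in_preds: "\<psi> \<in> R \<Longrightarrow> A \<in> set (body \<psi>) \<Longrightarrow> pred_of A \<in> preds R"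
  by (auto simp: preds_def)

section \<open>Skeletons and critical facts\<close>

lemma skel_subterm:
  assumes "t \<in> skel \<mu>" "s \<in> subterms t"
  shows "s \<in> skel \<mu>"
proof (cases t)
  case (Base a)
  then show ?thesis using assms by simp
next
  case (Fn f ts)
  then have "t \<in> terms_of (birth \<mu>)" using assms(1) by (auto simp: skel_def split: prod.splits)
  then have "s \<in> terms_of (birth \<mu>)" using assms(2) by (rule terms_of_subterm)
  then show ?thesis by (auto simp: skel_def split: prod.splits)
qed

text \<open>Constants of the frontier are put into the skeleton explicitly; a Skolem term occurs in
  the output of the trigger that created it, which is among its birth facts.\<close>

lemma frontier_in_skel:
  assumes "\<tau> x \<in> sk_terms R" "x \<in> set (frontier \<psi>)"
  shows "\<tau> x \<in> skel (\<psi>, \<tau>)"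
  using assms(1)
proof (cases rule: sk_terms.cases)
  case (1 c)
  then show ?thesis using imageI[OF assms(2), of \<tau>] by (auto simp: skel_def)
next
  case (2 \<rho> i y ts)
  \<comment> \<open>The substitution used by \<open>birth_term\<close>; it gives back
    \<open>ts\<close> because the frontier has no repetitions.\<close>
  let ?\<sigma> = "\<lambda>x. the (map_of (zip (frontier \<rho>) ts) x)"
  have d: "distinct (frontier \<rho>)" by (simp add: frontier_def)
  have "map ?\<sigma> (frontier \<rho>) = ts"
  proof (rule nth_equalityI)
    fix n assume "n < length (map ?\<sigma> (frontier \<rho>))"
    then show "map ?\<sigma> (frontier \<rho>) ! n = ts ! n"
      using d 2 by (simp add: map_of_zip_nth)
  qed (use 2 in simp)
  moreover have "y \<in> ex_vars i \<rho>" using 2 by (auto simp: sk_funs_def)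
  ultimately obtain A where A: "A \<in> out i (\<rho>, ?\<sigma>)" "\<tau> x \<in> set (args A)"
    using out_ex_term[of y i \<rho> ?\<sigma>] 2(1) by auto
  then have "A \<in> birth (\<psi>, \<tau>)" using assms(2) 2(1) by (auto simp: birth_def intro!: bexI[of _ x])
  then show ?thesis using A(2) by (auto simp: skel_def intro: args_in_terms_of)
qed

text \<open>Sending the existential variables to \<star> turns the first disjunct into facts over
  constants of the skeleton and \<star>, all of which the overapproximation contains.\<close>

lemma base_frontier_blocked:
  assumes wf: "wf_rule \<psi>" and R: "\<psi> \<in> R" and base: "\<tau> ` set (frontier \<psi>) \<subseteq> range Base"
  shows "obsolete (overapprox R (\<psi>, \<tau>) h) (\<psi>, \<tau>)"
proof -
  have b: "0 < branching \<psi>" using wf by (auto simp: wf_rule_def)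
  let ?\<sigma> = "\<lambda>v. if v \<in> body_vars \<psi> then \<tau> v else Base Star"
  have "map_atom ?\<sigma> A \<in> overapprox R (\<psi>, \<tau>) h" if A: "A \<in> set (head 0 \<psi>)" for A
  proof -
    have "Atom (pred_of A) (map ?\<sigma> (args A)) \<in> overapprox R (\<psi>, \<tau>) h"
    proof (rule overapprox.constants)
      show "pred_of A \<in> preds R" by (rule head_in_preds[OF R b A])
      show "length (map ?\<sigma> (args A)) = arity (pred_of A)" using head_wf[OF wf b A] by simp
      show "set (map ?\<sigma> (args A)) \<subseteq> insert (Base Star) (skel (\<psi>, \<tau>) \<inter> range Base)"
      proof
        fix t assume "t \<in> set (map ?\<sigma> (args A))"
        then obtain v where v: "v \<in> set (args A)" "t = ?\<sigma> v" by auto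
        show "t \<in> insert (Base Star) (skel (\<psi>, \<tau>) \<inter> range Base)"
          using head_var_cases[OF b A v(1)] v(2) base
          by (auto simp: skel_def ex_vars_def dest: frontier_body)
      qed
    qed
    then show ?thesis by (cases A) auto
  qed
  then show ?thesis using b unfolding obsolete_def by (auto intro!: exI[of _ 0] exI[of _ ?\<sigma>])
qed

section \<open>Firing of images of unblockable triggers\<close>

text \<open>The inverse of \<gamma> on the image of \<open>S\<close>, with \<star> as the value
  everywhere else.\<close>

definition pull :: "(gterm \<Rightarrow> gterm) \<Rightarrow> gterm set \<Rightarrow> gterm \<Rightarrow> gterm" where
  "pull \<gamma> S s = (if s \<in> \<gamma> ` S then the_inv_into S \<gamma> s else Base Star)"

lemma pull_image: "inj_on \<gamma> S \<Longrightarrow> t \<in> S \<Longrightarrow> pull \<gamma> S (\<gamma> t) = t"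
  by (simp add: pull_def the_inv_into_f_f)

lemma pull_cases:
  assumes "inj_on \<gamma> S"
  obtains t where "t \<in> S" "s = \<gamma> t" "pull \<gamma> S s = t" | "s \<notin> \<gamma> ` S" "pull \<gamma> S s = Base Star"
  using assms by (cases "s \<in> \<gamma> ` S") (auto simp: pull_image, auto simp: pull_def)

lemma pull_range: "inj_on \<gamma> S \<Longrightarrow> pull \<gamma> S s \<in> insert (Base Star) S"
  by (erule pull_cases[of \<gamma> S s]) auto

text \<open>With \<open>S\<close> a skeleton, the right-hand side is \<open>h_star\<close> of the
  Skolem term over the pulled-back frontier: pulling back commutes with Skolemization up to
  \<open>h_star\<close>. Assumption \<open>nb\<close> excludes a new term that is the image of a
  constant, since its pull-back would be that constant.\<close>

lemma pull_sk_val: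
  assumes hom: "hom \<gamma>" and inj: "inj_on \<gamma> S" and closed: "\<And>t s. t \<in> S \<Longrightarrow> s \<in> subterms t \<Longrightarrow> s \<in> S"
    and star: "Base Star \<notin> S"
    and v: "v \<in> ex_vars i \<psi> \<or> v \<in> set (frontier \<psi>)"
    and nb: "v \<in> ex_vars i \<psi> \<Longrightarrow> sk_val i \<psi> \<tau> v \<notin> \<gamma> ` (S \<inter> range Base)"
  shows "pull \<gamma> S (sk_val i \<psi> \<tau> v) =
    (let t = sk_val i \<psi> (\<lambda>x. pull \<gamma> S (\<tau> x)) v in if t \<in> S then t else Base Star)"
proof (cases "v \<in> ex_vars i \<psi>")
  case False
  then show ?thesis using v pull_range[OF inj, of "\<tau> v"] by (auto simp: sk_val_frontier Let_def)
next
  case True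
  let ?f = "Sk \<psi> i v" and ?fr = "frontier \<psi>" and ?k = "pull \<gamma> S"
  let ?s = "Fn ?f (map \<tau> ?fr)" and ?t = "Fn ?f (map (\<lambda>x. ?k (\<tau> x)) ?fr)"
  have "?k ?s = (if ?t \<in> S then ?t else Base Star)"
  proof (cases rule: pull_cases[OF inj, of ?s])
    case (1 t)
    have "t \<notin> range Base" using nb[OF True] 1 by (auto simp: sk_val_ex[OF True])
    then obtain f ts where t: "t = Fn f ts" by (cases t) auto
    have f: "f = ?f" and ts: "map \<tau> ?fr = map \<gamma> ts" using 1(2) hom unfolding t hom_def by auto
    have k\<gamma>: "map (?k \<circ> \<gamma>) ts = ts"
    proof (rule map_idI)
      fix x assume "x \<in> set ts"
      then have "x \<in> S" by (rule closed[OF 1(1)[unfolded t] subterms_arg])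
      then show "(?k \<circ> \<gamma>) x = x" by (simp add: pull_image[OF inj])
    qed
    have "map (\<lambda>x. ?k (\<tau> x)) ?fr = map ?k (map \<tau> ?fr)" by (simp add: comp_def)
    also have "\<dots> = ts" by (simp only: ts map_map k\<gamma>)
    finally have "map (\<lambda>x. ?k (\<tau> x)) ?fr = ts" .
    then show ?thesis using 1 t f by simp
  next
    case 2
    \<comment> \<open>Otherwise its arguments lie in \<open>S\<close> and differ from \<star>, so
      each frontier value is a genuine image, and \<open>?s\<close> would be the image of
      \<open>?t\<close>.\<close>
    have "?t \<notin> S"
    proof
      assume t: "?t \<in> S"
      have "\<gamma> (?k (\<tau> x)) = \<tau> x" if x: "x \<in> set ?fr" for x
      proof -
        have "?k (\<tau> x) \<in> S" using x by (intro closed[OF t] subterms_arg) auto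
        then show ?thesis using star by (cases rule: pull_cases[OF inj, of "\<tau> x"]) auto
      qed
      then have "\<gamma> ?t = ?s" using hom by (simp add: hom_def)
      then show False using imageI[OF t, of \<gamma>] 2(1) by simp
    qed
    then show ?thesis using 2 by simp
  qed
  then show ?thesis by (simp add: sk_val_ex[OF True] Let_def)
qed

text \<open>
  The rank conditions separate the images of constants of the skeleton from those of functional
  terms. They replace reversibility of a constant mapping.
\<close>

locale frontier_image =
  fixes R :: "rule set" and \<rho> \<psi> :: rule and \<pi> :: subst and \<gamma> :: "gterm \<Rightarrow> gterm" and M :: nat
  assumes wf: "\<forall>\<rho>\<in>R. wf_rule \<rho>"
    and det: "deterministic \<psi>"
    and unblockable: "star_unblockable R (\<psi>, \<pi>)"
    and frontier_sk: "\<pi> ` set (frontier \<psi>) \<subseteq> sk_terms R"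
    and skel_sk: "skel (\<psi>, \<pi>) \<subseteq> sk_terms R"
    and skel_Star: "Base Star \<notin> skel (\<psi>, \<pi>)"
    and hom: "hom \<gamma>" and inj: "inj_on \<gamma> (skel (\<psi>, \<pi>))"
    and rank_Base: "\<And>c. Base c \<in> skel (\<psi>, \<pi>) \<Longrightarrow> rank (sk_funs \<rho>) (\<gamma> (Base c)) \<le> M"
    and rank_Fn: "\<And>f ts. Fn f ts \<in> skel (\<psi>, \<pi>) \<Longrightarrow> M < rank (sk_funs \<rho>) (\<gamma> (Fn f ts))"
begin

abbreviation "\<mu> \<equiv> (\<psi>, \<pi>)"
abbreviation "S \<equiv> skel \<mu>"
abbreviation "\<O> \<equiv> overapprox R \<mu> (h_star \<mu>)"
abbreviation "k \<equiv> pull \<gamma> S"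

lemma branching_1: "branching \<psi> = 1"
  using det by (simp add: deterministic_def)

lemma frontier_skel: "x \<in> set (frontier \<psi>) \<Longrightarrow> \<pi> x \<in> S"
  using frontier_sk by (auto intro: frontier_in_skel)

lemma pull_sk: "k s \<in> sk_terms R"
  using pull_range[OF inj, of s] skel_sk by (auto intro: sk_terms.intros)

text \<open>The image of a functional skeleton term is functional and has rank above
  \<open>M\<close>. Hence all arguments are pulled back to skeleton constants or \<star>.\<close>

lemma critical_fact:
  assumes "pred_of A \<in> preds R" "wf_atom A" "\<And>t. t \<in> set (args A) \<Longrightarrow> rank (sk_funs \<rho>) t \<le> M \<or> t \<in> range Base"
  shows "map_atom k A \<in> \<O>"
proof -
  have "Atom (pred_of A) (map k (args A)) \<in> \<O>"
  proof (rule overapprox.constants)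
    show "set (map k (args A)) \<subseteq> insert (Base Star) (S \<inter> range Base)"
    proof
      fix s assume "s \<in> set (map k (args A))"
      then obtain t where t: "t \<in> set (args A)" "s = k t" by auto
      show "s \<in> insert (Base Star) (S \<inter> range Base)"
      proof (cases rule: pull_cases[OF inj, of t])
        case (1 u)
        then show ?thesis using assms(3)[OF t(1)] rank_Fn hom t
          by (cases u) (fastforce simp: hom_def)+
      qed (use t in simp)
    qed
  qed (use assms in simp_all)
  then show ?thesis by (cases A) auto
qed

text \<open>Unless it creates the image of a constant, the trigger pulls back to one loaded for the
  overapproximation. The closure then applies, except when the pulled-back trigger has the output of
  \<open>\<mu>\<close>; in that case the original trigger has the output of the image of
  \<open>\<mu>\<close>.\<close>

lemma pull_step:
  assumes trig: "is_trigger R (\<psi>', \<tau>)" and loaded: "loaded F (\<psi>', \<tau>)" and i: "i < branching \<psi>'"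
    and F: "map_atom k ` F \<subseteq> \<O>"
    and generating: "\<not> datalog \<psi>"
  shows "map_atom k ` out i (\<psi>', \<tau>) \<subseteq> \<O> \<or> out i (\<psi>', \<tau>) = out 0 (\<psi>, \<lambda>x. \<gamma> (\<pi> x))"
proof (cases "\<exists>v\<in>ex_vars i \<psi>'. sk_val i \<psi>' \<tau> v \<in> \<gamma> ` (S \<inter> range Base)")
  case True
  \<comment> \<open>Terms created together with the image of a constant have rank at most \<open>M\<close>, so they are pulled
    back to constants and \<open>\<star>\<close>, for which all facts are in the overapproximation.\<close>
  have \<psi>': "\<psi>' \<in> R" using trig by (simp add: is_trigger_def)
  let ?X = "sk_funs \<rho>"
  obtain v where v: "v \<in> ex_vars i \<psi>'" and vr: "rank ?X (Fn (Sk \<psi>' i v) (map \<tau> (frontier \<psi>'))) \<le> M"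
  proof -
    obtain v c where v: "v \<in> ex_vars i \<psi>'" "sk_val i \<psi>' \<tau> v = \<gamma> (Base c)" "Base c \<in> S"
      using True by blast
    show thesis using that[OF v(1)] rank_Base[OF v(3)] unfolding v(2)[symmetric] sk_val_ex[OF v(1)] .
  qed
  have "map_atom k A \<in> \<O>" if A: "A \<in> out i (\<psi>', \<tau>)" for A
  proof (rule critical_fact)
    obtain B where B: "B \<in> set (head i \<psi>')" "A = map_atom (sk_val i \<psi>' \<tau>) B"
      using A by (auto simp: out_eq)
    show "pred_of A \<in> preds R" using head_in_preds[OF \<psi>' i B(1)] B(2) by (simp add: atom.map_sel)
    show "wf_atom A" using head_wf[OF _ i B(1)] wf \<psi>' B(2) by (simp add: atom.map_sel)
    fix t assume "t \<in> set (args A)"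
    with i A have "rank ?X t \<le> M"
    proof (cases rule: out_args_cases)
      case (Ex w)
      \<comment> \<open>All terms created for one disjunct have the same arguments, and their
        symbols all belong to \<rho> or none does, so they have the same rank.\<close>
      then have "Sk \<psi>' i v \<in> ?X \<longleftrightarrow> Sk \<psi>' i w \<in> ?X" using v by (auto simp: sk_funs_def)
      then show ?thesis using vr Ex(2) by simp
    next
      case (Frontier x)
      then have "t \<in> subterms (Fn (Sk \<psi>' i v) (map \<tau> (frontier \<psi>')))" by (intro subterms_arg) auto
      then show ?thesis using vr by (blast intro: le_trans[OF rank_subterm])
    qed
    then show "rank ?X t \<le> M \<or> t \<in> range Base" ..
  qed
  then show ?thesis by blast
next
  case False
  let ?\<kappa> = "\<lambda>x. k (\<tau> x)"
  have eq: "map_atom k ` out i (\<psi>', \<tau>) = map_atom (h_star \<mu>) ` out i (\<psi>', ?\<kappa>)"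
    unfolding out_eq image_image map_atom_map_atom
  proof (rule image_map_atom_cong)
    fix A v assume "A \<in> set (head i \<psi>')" "v \<in> set (args A)"
    then have "v \<in> ex_vars i \<psi>' \<or> v \<in> set (frontier \<psi>')" by (rule head_var_cases[OF i])
    then have "k (sk_val i \<psi>' \<tau> v) =
        (let t = sk_val i \<psi>' ?\<kappa> v in if t \<in> S then t else Base Star)"
      using False by (intro pull_sk_val hom inj skel_Star) (auto intro: skel_subterm)
    then show "k (sk_val i \<psi>' \<tau> v) = h_star \<mu> (sk_val i \<psi>' ?\<kappa> v)"
      by (simp add: h_star_def Let_def)
  qed
  show ?thesis
  \<comment> \<open>Exactly the triggers that the overapproximation excludes; disjunct 0 suffices
    because \<psi> is deterministic.\<close>
  proof (cases "\<psi>' = \<psi> \<and> out 0 (\<psi>, ?\<kappa>) = out 0 \<mu>")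
    case True
    obtain y where y: "y \<in> ex_vars 0 \<psi>"
      using generating det by (auto simp: datalog_def generating_def deterministic_def)
    have "\<tau> x = \<gamma> (\<pi> x)" if x: "x \<in> set (frontier \<psi>)" for x
    proof -
      have "k (\<tau> x) = \<pi> x" using out_inj[OF _ y _ x, of ?\<kappa> \<pi>] True branching_1 by simp
      then show ?thesis using frontier_skel[OF x] skel_Star by (cases rule: pull_cases[OF inj, of "\<tau> x"]) auto
    qed
    then show ?thesis using out_cong[of 0 \<psi> \<tau>] i branching_1 True by auto
  next
    case False
    have "is_trigger R (\<psi>', ?\<kappa>)" using trig pull_sk by (auto simp: is_trigger_def)
    moreover have "loaded \<O> (\<psi>', ?\<kappa>)"
      using loaded F by (auto simp: loaded_def map_atom_map_atom[symmetric])
    moreover have "\<psi>' = fst \<mu> \<longrightarrow> (\<exists>j<branching \<psi>'. out j (\<psi>', ?\<kappa>) \<noteq> out j \<mu>)"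
      using False i branching_1 by auto
    ultimately have "map_atom (h_star \<mu>) A \<in> \<O>" if "A \<in> out i (\<psi>', ?\<kappa>)" for A
      using i that by (rule overapprox.step)
    then have "map_atom (h_star \<mu>) ` out i (\<psi>', ?\<kappa>) \<subseteq> \<O>" by blast
    then show ?thesis using eq by simp
  qed
qed

text \<open>The database has only constants, so its pull-back consists of critical facts. A
  derivation can leave the overapproximation only through the output of the image trigger, which
  then persists.\<close>

lemma deriv_pull:
  assumes "deriv R (rule_db \<rho>) F" "\<rho> \<in> R" "\<not> datalog \<psi>"
  shows "map_atom k ` F \<subseteq> \<O> \<or> out 0 (\<psi>, \<lambda>x. \<gamma> (\<pi> x)) \<subseteq> F"
  using assms(1)
proof induction
  case init
  have "map_atom k A \<in> \<O>" if A: "A \<in> rule_db \<rho>" for A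
  proof -
    obtain B where B: "B \<in> set (body \<rho>)" "A = map_atom \<sigma>_uc B" using A by (auto simp: rule_db_def)
    have "wf_atom B" using wf assms(2) B(1) by (auto simp: wf_rule_def)
    then show ?thesis using B body_in_preds[OF assms(2) B(1)]
      by (intro critical_fact) (auto simp: atom.map_sel \<sigma>_uc_def)
  qed
  then show ?case by blast
next
  case (step F \<psi>' \<tau> i)
  then show ?case using pull_step[of \<psi>' \<tau> F i] assms(3) by blast
qed

text \<open>In a model the loaded image is obsolete. For a datalog rule the output is then already
  present; otherwise the witness of obsoleteness would pull back to \<open>\<mu>\<close>, contrary
  to unblockability, unless the image trigger was applied.\<close>

lemma fires:
  assumes F: "deriv R (rule_db \<rho>) F" "\<rho> \<in> R" "satisfies F \<psi>"
    and loaded: "loaded F (\<psi>, \<lambda>x. \<gamma> (\<pi> x))"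
  shows "out 0 (\<psi>, \<lambda>x. \<gamma> (\<pi> x)) \<subseteq> F"
proof -
  obtain \<sigma> where \<sigma>: "\<And>x. x \<in> body_vars \<psi> \<Longrightarrow> \<sigma> x = \<gamma> (\<pi> x)" "map_atom \<sigma> ` set (head 0 \<psi>) \<subseteq> F"
  proof -
    have "obsolete F (\<psi>, \<lambda>x. \<gamma> (\<pi> x))" using F(3) loaded by (simp add: satisfies_def)
    then show thesis using that branching_1 by (auto simp: obsolete_def)
  qed
  have v: "v \<in> ex_vars 0 \<psi> \<or> v \<in> set (frontier \<psi>)" if "A \<in> set (head 0 \<psi>)" "v \<in> set (args A)" for A v
    using head_var_cases[OF _ that] branching_1 by simp
  show ?thesis
  proof (cases "datalog \<psi>")
    case True
    then have "ex_vars 0 \<psi> = {}" by (auto simp: datalog_def generating_def deterministic_def)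
    then have "out 0 (\<psi>, \<lambda>x. \<gamma> (\<pi> x)) = map_atom \<sigma> ` set (head 0 \<psi>)"
      unfolding out_eq using v \<sigma>(1)
      by (intro image_map_atom_cong) (fastforce simp: sk_val_frontier dest: frontier_body)
    then show ?thesis using \<sigma>(2) by simp
  next
    case False
    have "\<not> map_atom k ` F \<subseteq> \<O>"
    proof
      assume k: "map_atom k ` F \<subseteq> \<O>"
      \<comment> \<open>Must extend \<pi> on the whole body. On the head it agrees with the
        pull-back of \<sigma>, since body variables of the head are frontier variables, whose values
        lie in \<open>S\<close>.\<close>
      let ?\<sigma> = "\<lambda>x. if x \<in> body_vars \<psi> then \<pi> x else k (\<sigma> x)"
      have "map_atom ?\<sigma> A \<in> \<O>" if A: "A \<in> set (head 0 \<psi>)" for A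
      proof -
        have "?\<sigma> x = k (\<sigma> x)" if "x \<in> set (args A)" for x
          using v[OF A that] pull_image[OF inj frontier_skel, of x] \<sigma>(1)[of x]
          by (auto simp: ex_vars_def dest: frontier_body)
        then have "map_atom ?\<sigma> A = map_atom k (map_atom \<sigma> A)"
          unfolding map_atom_map_atom by (intro map_atom_cong) blast
        then show ?thesis using k \<sigma>(2) A by auto
      qed
      then have "obsolete \<O> \<mu>"
        using branching_1 by (auto simp: obsolete_def intro!: exI[of _ ?\<sigma>])
      then show False using unblockable False by (simp add: star_unblockable_def)
    qed
    then show ?thesis using deriv_pull[OF F(1,2) False] by blast
  qed
qed

end

lemma loaded_subset: "loaded F \<mu> \<Longrightarrow> F \<subseteq> G \<Longrightarrow> loaded G \<mu>"
  by (auto simp: loaded_def)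

section \<open>The facts before the second application of the rule\<close>

text \<open>A closure like \<open>DRPC_facts\<close> in which \<rho> is applied only under
  \<open>\<sigma>_uc\<close>.\<close>

inductive_set core :: "rule set \<Rightarrow> rule \<Rightarrow> fact set" for R \<rho> where
  db: "A \<in> rule_db \<rho> \<Longrightarrow> A \<in> core R \<rho>"
| start: "A \<in> out 0 (\<rho>, \<sigma>_uc) \<Longrightarrow> A \<in> core R \<rho>"
| step: "is_trigger R (\<psi>, \<tau>) \<Longrightarrow> deterministic \<psi> \<Longrightarrow> loaded (core R \<rho>) (\<psi>, \<tau>) \<Longrightarrow>
    star_unblockable R (\<psi>, \<tau>) \<Longrightarrow> \<psi> \<noteq> \<rho> \<Longrightarrow> A \<in> out 0 (\<psi>, \<tau>) \<Longrightarrow> A \<in> core R \<rho>"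

definition start_term :: "rule \<Rightarrow> var \<Rightarrow> gterm" where
  "start_term \<rho> y = Fn (Sk \<rho> 0 y) (map \<sigma>_uc (frontier \<rho>))"

lemma birth_term_sk:
  "birth_term (Fn (Sk \<psi> i v) (map \<tau> (frontier \<psi>))) =
     out i (\<psi>, \<lambda>x. the (map_of (zip (frontier \<psi>) (map \<tau> (frontier \<psi>))) x)) \<union>
     (\<Union>x\<in>set (frontier \<psi>). birth_term (\<tau> x))"
  by simp

locale generating_rule =
  fixes R :: "rule set" and \<rho> :: rule
  assumes wf: "\<forall>\<rho>\<in>R. wf_rule \<rho>" and rule: "\<rho> \<in> R"
    and det: "deterministic \<rho>" and gen: "generating \<rho>"
begin

abbreviation "X \<equiv> sk_funs \<rho>"
abbreviation "C \<equiv> core R \<rho>"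

lemma branching_1: "branching \<rho> = 1"
  using det by (simp add: deterministic_def)

lemma ex_var: obtains y where "y \<in> ex_vars 0 \<rho>"
  using gen branching_1 by (auto simp: generating_def)

lemma Sk_in_X: "Sk \<psi> 0 v \<in> X \<longleftrightarrow> \<psi> = \<rho> \<and> v \<in> ex_vars 0 \<rho>"
  using branching_1 by (auto simp: sk_funs_def)

text \<open>The invariant of the terms of the core. The condition on birth facts keeps skeletons
  inside the core; the last line gives functional terms exactly one level of \<rho> and a start
  term.\<close>

definition good :: "gterm \<Rightarrow> bool" where
  "good t \<longleftrightarrow> t \<in> sk_terms R \<and> birth_term t \<subseteq> C \<and>
     (case t of
        Base c \<Rightarrow> c \<in> VarCst ` body_vars \<rho>
      | Fn f ts \<Rightarrow> rank X t = 1 \<and> (\<exists>y\<in>ex_vars 0 \<rho>. start_term \<rho> y \<in> subterms t))"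

lemma good_rank: "good t \<Longrightarrow> rank X t = (if t \<in> range Base then 0 else 1)"
  by (cases t) (auto simp: good_def)

lemma good_rank_Fn: "good (Fn f ts) \<Longrightarrow> rank X (Fn f ts) = Suc 0"
  by (simp add: good_def)

text \<open>For \<rho> the new term is itself a start term over constants. Any other rule adds no
  level of \<rho>, and rank and start term are inherited from a functional frontier value.\<close>

lemma good_new:
  assumes \<psi>: "\<psi> \<in> R" "deterministic \<psi>" and v: "v \<in> ex_vars 0 \<psi>"
    and fr: "\<And>x. x \<in> set (frontier \<psi>) \<Longrightarrow> good (\<tau> x)" and out: "out 0 (\<psi>, \<tau>) \<subseteq> C"
    and cases: "\<psi> = \<rho> \<and> \<tau> = \<sigma>_uc \<or> \<psi> \<noteq> \<rho> \<and> \<not> \<tau> ` set (frontier \<psi>) \<subseteq> range Base"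
  shows "good (Fn (Sk \<psi> 0 v) (map \<tau> (frontier \<psi>)))" (is "good ?t")
proof -
  have b: "0 < branching \<psi>" using \<psi>(2) by (simp add: deterministic_def)
  have "?t \<in> sk_terms R"
    using \<psi>(1) v b fr by (intro sk_terms.intros) (auto simp: sk_funs_def good_def)
  moreover have "birth_term ?t \<subseteq> C"
  proof -
    have "out 0 (\<psi>, \<lambda>x. the (map_of (zip (frontier \<psi>) (map \<tau> (frontier \<psi>))) x)) = out 0 (\<psi>, \<tau>)"
      using b by (intro out_cong) (auto simp: map_of_zip_map)
    then show ?thesis using out fr unfolding birth_term_sk by (auto simp: good_def)
  qed
  moreover have "rank X ?t = 1 \<and> (\<exists>y\<in>ex_vars 0 \<rho>. start_term \<rho> y \<in> subterms ?t)"
  proof (cases "\<psi> = \<rho>")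
    case True
    then have \<tau>: "\<tau> = \<sigma>_uc" using cases by simp
    have "rank X ?t \<le> of_bool (Sk \<psi> 0 v \<in> X) + 0"
      by (rule rank_le) (auto simp: \<tau> \<sigma>_uc_def)
    moreover have "Sk \<psi> 0 v \<in> X" using v True by (simp add: Sk_in_X)
    ultimately show ?thesis using v True \<tau> by (auto simp: start_term_def)
  next
    case False
    then obtain x where x: "x \<in> set (frontier \<psi>)" "\<tau> x \<notin> range Base" using cases by auto
    have sub: "\<tau> x \<in> subterms ?t" using x by (intro subterms_arg) auto
    have "rank X ?t \<le> of_bool (Sk \<psi> 0 v \<in> X) + 1"
      by (rule rank_le) (auto dest!: fr simp: good_rank)
    moreover have "Sk \<psi> 0 v \<notin> X" using False by (simp add: Sk_in_X)
    moreover have "1 \<le> rank X ?t"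
      using rank_subterm[OF sub, of X] good_rank[OF fr[OF x(1)]] x(2) by simp
    moreover have "\<exists>y\<in>ex_vars 0 \<rho>. start_term \<rho> y \<in> subterms (\<tau> x)"
      using fr[OF x(1)] x(2) by (auto simp: good_def split: trm.splits)
    ultimately show ?thesis using subterms_trans[OF _ sub] by force
  qed
  ultimately show ?thesis by (simp add: good_def)
qed

lemma good_VarCst: "x \<in> body_vars \<rho> \<Longrightarrow> good (\<sigma>_uc x)"
  by (auto simp: good_def \<sigma>_uc_def intro: sk_terms.intros)

lemma subterms_map_cases:
  assumes "s \<in> subterms (Fn f (map \<tau> xs))"
  obtains "s = Fn f (map \<tau> xs)" | x where "x \<in> set xs" "s \<in> subterms (\<tau> x)"
  using assms by auto

lemma core_good: "A \<in> C \<Longrightarrow> \<forall>t\<in>terms_of {A}. good t"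
proof (induction rule: core.induct)
  case (db A)
  then obtain B where B: "B \<in> set (body \<rho>)" "A = map_atom \<sigma>_uc B" by (auto simp: rule_db_def)
  have "good s" if "x \<in> set (args B)" "s \<in> subterms (\<sigma>_uc x)" for x s
  proof -
    have "s = \<sigma>_uc x" using that(2) by (simp add: \<sigma>_uc_def)
    then show ?thesis using good_VarCst body_varsI[OF B(1) that(1)] by simp
  qed
  then show ?case using B by (auto simp: terms_of_def atom.map_sel)
next
  case (start A)
  have fr: "good (\<sigma>_uc x)" if "x \<in> set (frontier \<rho>)" for x
    using that by (simp add: good_VarCst frontier_body)
  have b: "0 < branching \<rho>" using branching_1 by simp
  have "good s" if t: "t \<in> set (args A)" and s: "s \<in> subterms t" for t s
    using b start t
  proof (cases rule: out_args_cases)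
    case (Ex v)
    have "good t" unfolding Ex(2) using fr
      by (intro good_new rule det Ex) (auto intro: core.start)
    then show ?thesis using fr unfolding Ex(2)
      by (cases rule: subterms_map_cases[OF s[unfolded Ex(2)]]) (auto simp: \<sigma>_uc_def)
  next
    case (Frontier x)
    then show ?thesis using s fr by (auto simp: \<sigma>_uc_def)
  qed
  then show ?case by (auto simp: terms_of_def)
next
  case (step \<psi> \<tau> A)
  \<comment> \<open>By the induction hypothesis the trigger is loaded for this set, so its frontier
    values and all their subterms are good.\<close>
  let ?G = "{A \<in> C. \<forall>t\<in>terms_of {A}. good t}"
  have \<psi>: "\<psi> \<in> R" using step.hyps(1) by (simp add: is_trigger_def)
  have b: "0 < branching \<psi>" using step.hyps(2) by (simp add: deterministic_def)
  have G: "good s" if "x \<in> set (frontier \<psi>)" "s \<in> subterms (\<tau> x)" for x s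
  proof -
    have "\<tau> x \<in> terms_of ?G" using step.IH that(1) by (auto intro: loaded_terms frontier_body)
    then have "s \<in> terms_of ?G" using that(2) by (rule terms_of_subterm)
    then show ?thesis by (auto simp: terms_of_def)
  qed
  have out: "out 0 (\<psi>, \<tau>) \<subseteq> C"
    using step.hyps loaded_subset[OF step.IH] by (auto intro: core.step)
  have "good s" if t: "t \<in> set (args A)" and s: "s \<in> subterms t" for t s
    using b \<open>A \<in> out 0 (\<psi>, \<tau>)\<close> t
  proof (cases rule: out_args_cases)
    case (Ex v)
    have nd: "\<not> datalog \<psi>" using Ex(1) b by (auto simp: datalog_def generating_def)
    \<comment> \<open>Unblockability provides the functional frontier value that
      \<open>good_new\<close> requires.\<close>
    then have "\<not> \<tau> ` set (frontier \<psi>) \<subseteq> range Base"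
      using base_frontier_blocked[of \<psi> R \<tau>] wf \<psi> \<open>star_unblockable R (\<psi>, \<tau>)\<close>
      by (auto simp: star_unblockable_def)
    then have "good t" unfolding Ex(2) using G[OF _ subterms_refl] step.hyps
      by (intro good_new \<psi> out Ex) auto
    then show ?thesis using G unfolding Ex(2)
      by (cases rule: subterms_map_cases[OF s[unfolded Ex(2)]]) auto
  next
    case (Frontier x)
    then show ?thesis using s G by auto
  qed
  then show ?case by (auto simp: terms_of_def)
qed

lemma core_terms_good: "t \<in> terms_of C \<Longrightarrow> good t"
  using core_good by (fastforce simp: terms_of_def)

lemma core_Base: "Base c \<in> terms_of C \<Longrightarrow> \<exists>x\<in>body_vars \<rho>. Base c = \<sigma>_uc x"
  by (auto dest!: core_terms_good simp: good_def \<sigma>_uc_def)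

lemma skel_core:
  assumes "loaded C (\<psi>, \<tau>)"
  shows "skel (\<psi>, \<tau>) \<subseteq> terms_of C"
proof -
  have *: "\<tau> x \<in> terms_of C" if "x \<in> set (frontier \<psi>)" for x
    using assms that by (auto intro: loaded_terms frontier_body)
  then have "birth_term (\<tau> x) \<subseteq> C" if "x \<in> set (frontier \<psi>)" for x
    using core_terms_good[OF *[OF that]] by (simp add: good_def)
  then have "birth (\<psi>, \<tau>) \<subseteq> C" by (auto simp: birth_def)
  then show ?thesis using * by (auto simp: skel_def dest: terms_of_mono)
qed

text \<open>While the construction stays in the core, a further application of \<rho> is loaded for
  the core and so is the required trigger; any other rule leads again into the core.\<close>

lemma DRPC_facts_cases:
  assumes "A \<in> DRPC_facts R \<rho>"
  shows "A \<in> C \<or> (\<exists>\<tau>. is_trigger R (\<rho>, \<tau>) \<and> loaded C (\<rho>, \<tau>) \<and> star_unblockable R (\<rho>, \<tau>) \<and>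
    inj_on \<tau> (body_vars \<rho>))" (is "_ \<or> ?Q")
  using assms
proof (induction rule: DRPC_facts.induct)
  case (step \<psi> \<tau> A)
  show ?case
  proof (cases ?Q)
    case False
    then have "loaded C (\<psi>, \<tau>)" using step.IH by (auto elim!: loaded_subset)
    then show ?thesis using step.hyps False by (cases "\<psi> = \<rho>") (auto intro: core.step)
  qed simp
qed (auto intro: core.intros)

lemma rule_cyclic_rank:
  assumes "rule_cyclic \<rho> t"
  shows "2 \<le> rank X t"
proof -
  obtain f ss s where t: "t = Fn f ss" and f: "f \<in> X" and s: "s \<in> set ss" "f \<in> funs s"
    using assms by (auto simp: rule_cyclic_def)
  show ?thesis using rank_arg[OF s(1), of f X] rank_funs[OF s(2) f] f unfolding t by (simp del: rank.simps)
qed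

text \<open>A \<rho>-cyclic term has two levels of \<rho>, whereas terms of the core have at most
  one, so the construction must leave the core.\<close>

lemma recurrent_trigger:
  assumes "t \<in> terms_of (DRPC_facts R \<rho>)" "rule_cyclic \<rho> t"
  obtains \<tau> where "is_trigger R (\<rho>, \<tau>)" "loaded C (\<rho>, \<tau>)" "star_unblockable R (\<rho>, \<tau>)"
    "inj_on \<tau> (body_vars \<rho>)"
proof -
  have "t \<notin> terms_of C"
  proof
    assume "t \<in> terms_of C"
    then have "rank X t = (if t \<in> range Base then 0 else 1)" by (intro good_rank core_terms_good)
    then show False using rule_cyclic_rank[OF assms(2)] by (simp split: if_splits)
  qed
  then have "\<not> DRPC_facts R \<rho> \<subseteq> C" using assms(1) terms_of_mono by blast
  then show thesis using DRPC_facts_cases that by blast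
qed

end

section \<open>Iterating the constant mapping\<close>

primrec lift :: "(const \<Rightarrow> gterm) \<Rightarrow> gterm \<Rightarrow> gterm" where
  "lift \<theta> (Base c) = \<theta> c"
| "lift \<theta> (Fn f ts) = Fn f (map (lift \<theta>) ts)"

lemma hom_lift: "hom (lift \<theta>)"
  by (simp add: hom_def)

text \<open>\<open>F\<close> stands for a model obtained from a chase. The output of the start
  trigger is assumed because unblockability cannot force that trigger to fire.\<close>

locale recurrence = generating_rule +
  fixes \<tau> :: subst and F :: "fact set"
  assumes trig: "is_trigger R (\<rho>, \<tau>)" and loaded: "loaded (core R \<rho>) (\<rho>, \<tau>)"
    and unblockable: "star_unblockable R (\<rho>, \<tau>)" and inj: "inj_on \<tau> (body_vars \<rho>)"
    and deriv: "deriv R (rule_db \<rho>) F" and sat: "\<And>\<psi>. \<psi> \<in> R \<Longrightarrow> satisfies F \<psi>"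
    and start: "out 0 (\<rho>, \<sigma>_uc) \<subseteq> F"
begin

definition \<gamma> :: "nat \<Rightarrow> gterm \<Rightarrow> gterm" where
  "\<gamma> m = lift (\<lambda>c. case c of VarCst x \<Rightarrow> \<tau> x | _ \<Rightarrow> Base c) ^^ m"

lemma \<gamma>_0: "\<gamma> 0 t = t"
  by (simp add: \<gamma>_def)

lemma \<gamma>_Suc: "\<gamma> (Suc m) (\<sigma>_uc x) = \<gamma> m (\<tau> x)"
  by (simp add: \<gamma>_def funpow_swap1 \<sigma>_uc_def)

lemma hom_\<gamma>: "hom (\<gamma> m)"
  unfolding \<gamma>_def by (intro hom_funpow hom_lift)

lemma \<gamma>_Fn: "\<gamma> m (Fn f ts) = Fn f (map (\<gamma> m) ts)"
  using hom_\<gamma> by (simp add: hom_def)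

lemma \<tau>_core: "x \<in> body_vars \<rho> \<Longrightarrow> \<tau> x \<in> terms_of C"
  using loaded by (rule loaded_terms)

lemma functional: obtains x where "x \<in> set (frontier \<rho>)" "\<tau> x \<notin> range Base"
proof -
  have "\<not> datalog \<rho>" using gen by (simp add: datalog_def)
  then have "\<not> \<tau> ` set (frontier \<rho>) \<subseteq> range Base"
    using base_frontier_blocked[of \<rho> R \<tau>] wf rule unblockable by (auto simp: star_unblockable_def)
  then show thesis using that by blast
qed

text \<open>Both claims need a joint induction: one more iteration sends a constant to the previous
  image of some \<open>\<tau> x\<close>, which may be functional. A functional term adds its single
  level of \<rho> to the ranks of its constants.\<close>

lemma rank_\<gamma>_const_Fn:
  "(\<forall>x\<in>body_vars \<rho>. rank X (\<gamma> m (\<sigma>_uc x)) \<le> m) \<and>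
   (\<forall>f ts. Fn f ts \<in> terms_of C \<longrightarrow> rank X (\<gamma> m (Fn f ts)) = Suc m)"
proof (induction m)
  case 0
  have "rank X (Fn f ts) = Suc 0" if "Fn f ts \<in> terms_of C" for f ts
    using core_terms_good[OF that] by (simp only: good_rank_Fn)
  then show ?case by (simp only: \<gamma>_0) (simp add: \<sigma>_uc_def)
next
  case (Suc m)
  \<comment> \<open>The constant of \<open>z\<close> is an argument of every start term, and its
    image attains the bound for constants; this gives the lower bound for functional terms.\<close>
  obtain z where z: "z \<in> set (frontier \<rho>)" "\<tau> z \<notin> range Base" by (rule functional)
  have le: "rank X (\<gamma> (Suc m) (\<sigma>_uc x)) \<le> Suc m" if x: "x \<in> body_vars \<rho>" for x
  proof (cases "\<tau> x")
    case (Base c)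
    then have "Base c \<in> terms_of C" using \<tau>_core[OF x] by simp
    from core_Base[OF this] obtain w where w: "w \<in> body_vars \<rho>" "\<tau> x = \<sigma>_uc w" using Base by auto
    have "rank X (\<gamma> m (\<sigma>_uc w)) \<le> m" using Suc.IH w(1) by blast
    then show ?thesis by (simp add: \<gamma>_Suc w(2))
  next
    case (Fn f ts)
    then show ?thesis using conjunct2[OF Suc.IH, rule_format, of f ts] \<tau>_core[OF x] by (simp add: \<gamma>_Suc)
  qed
  have ge: "rank X (\<gamma> (Suc m) (\<sigma>_uc z)) = Suc m"
  proof (cases "\<tau> z")
    case (Fn f ts)
    then have "Fn f ts \<in> terms_of C" using \<tau>_core[OF frontier_body[OF z(1)]] by simp
    then show ?thesis using Suc.IH Fn by (simp add: \<gamma>_Suc)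
  qed (use z in simp)
  have "rank X (\<gamma> (Suc m) (Fn f ts)) = Suc (Suc m)" if t: "Fn f ts \<in> terms_of C" for f ts
  proof (rule antisym)
    note good = core_terms_good[OF t]
    have "rank X (\<gamma> (Suc m) (Fn f ts)) \<le> rank X (Fn f ts) + Suc m"
    proof (rule rank_hom_le[OF hom_\<gamma>])
      fix c assume "Base c \<in> subterms (Fn f ts)"
      then have "Base c \<in> terms_of C" by (rule terms_of_subterm[OF t])
      from core_Base[OF this] show "rank X (\<gamma> (Suc m) (Base c)) \<le> Suc m" using le by auto
    qed
    then show "rank X (\<gamma> (Suc m) (Fn f ts)) \<le> Suc (Suc m)" by (simp only: good_rank_Fn[OF good] add_Suc add_0)
    obtain y where y: "y \<in> ex_vars 0 \<rho>" "start_term \<rho> y \<in> subterms (Fn f ts)"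
      using good by (auto simp: good_def)
    have z': "\<gamma> (Suc m) (\<sigma>_uc z) \<in> set (map (\<gamma> (Suc m)) (map \<sigma>_uc (frontier \<rho>)))" using z by auto
    have "Sk \<rho> 0 y \<in> X" using y(1) by (simp add: Sk_in_X)
    then have "Suc (Suc m) = of_bool (Sk \<rho> 0 y \<in> X) + rank X (\<gamma> (Suc m) (\<sigma>_uc z))" by (simp add: ge)
    also have "\<dots> \<le> rank X (\<gamma> (Suc m) (start_term \<rho> y))"
      unfolding start_term_def \<gamma>_Fn by (rule rank_arg[OF z'])
    also have "\<dots> \<le> rank X (\<gamma> (Suc m) (Fn f ts))"
      by (rule rank_subterm[OF hom_subterm[OF hom_\<gamma> y(2)]])
    finally show "Suc (Suc m) \<le> rank X (\<gamma> (Suc m) (Fn f ts))" .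
  qed
  then show ?case using le by blast
qed

lemma rank_\<gamma>_Base: "Base c \<in> terms_of C \<Longrightarrow> rank X (\<gamma> m (Base c)) \<le> m"
  using core_Base[of c] rank_\<gamma>_const_Fn[of m] by auto

lemma rank_\<gamma>_Fn: "Fn f ts \<in> terms_of C \<Longrightarrow> rank X (\<gamma> m (Fn f ts)) = Suc m"
  using rank_\<gamma>_const_Fn by blast

lemma \<gamma>_Base_neq_Fn:
  "Base c \<in> terms_of C \<Longrightarrow> Fn f ts \<in> terms_of C \<Longrightarrow> \<gamma> m (Base c) \<noteq> \<gamma> m (Fn f ts)"
  using rank_\<gamma>_Base[of c m] rank_\<gamma>_Fn[of f ts m] by auto

text \<open>Rank separates constants from functional terms. Two constants reduce to injectivity of
  \<tau> and the previous iterate, two functional terms to their arguments.\<close>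

lemma inj_\<gamma>: "inj_on (\<gamma> m) (terms_of C)"
proof (induction m)
  case 0
  then show ?case by (simp add: inj_on_def \<gamma>_0)
next
  case (Suc m)
  have "s = t" if "s \<in> terms_of C" "t \<in> terms_of C" "\<gamma> (Suc m) s = \<gamma> (Suc m) t" for s t
    using that
  proof (induction s arbitrary: t)
    case (Base c)
    then obtain d where t: "t = Base d" using \<gamma>_Base_neq_Fn by (cases t) auto
    obtain x y where "x \<in> body_vars \<rho>" "Base c = \<sigma>_uc x" "y \<in> body_vars \<rho>" "t = \<sigma>_uc y"
      using Base t core_Base by metis
    then show ?case using Base.prems(3) Suc.IH inj \<tau>_core by (auto simp: \<gamma>_Suc dest!: inj_onD)
  next
    case (Fn f ss)
    then obtain ts where t: "t = Fn f ts" using \<gamma>_Base_neq_Fn[of _ f ss "Suc m"]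
      by (cases t) (auto simp: \<gamma>_Fn)
    have eq: "map (\<gamma> (Suc m)) ss = map (\<gamma> (Suc m)) ts" using Fn.prems(3) t by (simp add: \<gamma>_Fn)
    then have len: "length ss = length ts" by (rule map_eq_imp_length_eq)
    have "ss = ts"
    proof (rule nth_equalityI[OF len])
      fix n assume n: "n < length ss"
      have eq_n: "\<gamma> (Suc m) (ss ! n) = \<gamma> (Suc m) (ts ! n)" using arg_cong[OF eq, of "\<lambda>xs. xs ! n"] n len by simp
      have "ss ! n \<in> set ss" "ts ! n \<in> set ts" using n len by auto
      then show "ss ! n = ts ! n"
        using Fn.IH[OF _ terms_of_arg[OF Fn.prems(1)] terms_of_arg[OF Fn.prems(2)[unfolded t]] eq_n] by blast
    qed
    then show ?case using t by simp
  qed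
  then show ?case by (rule inj_onI)
qed

text \<open>The instance \<open>M = m\<close>: images of constants have rank at most
  \<open>m\<close>, those of functional terms rank \<open>m + 1\<close>.\<close>

lemma fires:
  assumes "is_trigger R (\<psi>, \<pi>)" "deterministic \<psi>" "loaded C (\<psi>, \<pi>)" "star_unblockable R (\<psi>, \<pi>)"
    and "loaded F (\<psi>, \<lambda>x. \<gamma> m (\<pi> x))"
  shows "out 0 (\<psi>, \<lambda>x. \<gamma> m (\<pi> x)) \<subseteq> F"
proof -
  have \<psi>: "\<psi> \<in> R" using assms(1) by (simp add: is_trigger_def)
  note skel = skel_core[OF assms(3)]
  interpret I: frontier_image R \<rho> \<psi> \<pi> "\<gamma> m" m
  proof
    show "\<pi> ` set (frontier \<psi>) \<subseteq> sk_terms R"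
      using assms(1) by (auto simp: is_trigger_def dest: frontier_body)
    show "skel (\<psi>, \<pi>) \<subseteq> sk_terms R"
      using skel core_terms_good by (auto simp: good_def)
    show "Base Star \<notin> skel (\<psi>, \<pi>)" using skel core_Base by (auto simp: \<sigma>_uc_def)
    show "inj_on (\<gamma> m) (skel (\<psi>, \<pi>))" using inj_\<gamma> skel by (rule inj_on_subset)
  qed (use wf \<psi> assms hom_\<gamma> rank_\<gamma>_Base rank_\<gamma>_Fn skel in auto)
  show ?thesis using deriv rule sat[OF \<psi>] assms(5) by (rule I.fires)
qed

lemma loaded_map: "loaded {A \<in> C. map_atom h A \<in> F} (\<psi>, \<pi>) \<Longrightarrow> loaded F (\<psi>, \<lambda>x. h (\<pi> x))"
  by (auto simp: loaded_def map_atom_map_atom)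

lemma map_core_step:
  assumes db: "\<And>A. A \<in> rule_db \<rho> \<Longrightarrow> map_atom (\<gamma> m) A \<in> F"
    and start: "out 0 (\<rho>, \<lambda>x. \<gamma> m (\<sigma>_uc x)) \<subseteq> F"
    and A: "A \<in> C"
  shows "map_atom (\<gamma> m) A \<in> F"
  using A
proof (induction rule: core.induct)
  case (start A)
  then show ?case using assms(2) hom_out[OF hom_\<gamma>, of m 0 \<rho> \<sigma>_uc] by auto
next
  case (step \<psi> \<pi> A)
  have "loaded C (\<psi>, \<pi>)" using step.IH by (auto elim: loaded_subset)
  then have "out 0 (\<psi>, \<lambda>x. \<gamma> m (\<pi> x)) \<subseteq> F" using step.hyps step.IH by (intro fires loaded_map)
  then show ?case using hom_out[OF hom_\<gamma>, of m 0 \<psi> \<pi>] step.hyps by auto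
qed (rule db)

text \<open>The next copy of the database is the current copy of the body of the recurrent trigger,
  which lies in the core.\<close>

lemma map_core: "A \<in> C \<Longrightarrow> map_atom (\<gamma> m) A \<in> F"
proof (induction m arbitrary: A)
  case 0
  have id: "\<gamma> 0 = (\<lambda>t. t)" by (simp add: \<gamma>_0 fun_eq_iff)
  show ?case
  proof (rule map_core_step[OF _ _ 0])
    show "map_atom (\<gamma> 0) A \<in> F" if "A \<in> rule_db \<rho>" for A
      using that deriv_subset[OF deriv] by (auto simp: id atom.map_ident)
    show "out 0 (\<rho>, \<lambda>x. \<gamma> 0 (\<sigma>_uc x)) \<subseteq> F" using start by (simp add: id)
  qed
next
  case (Suc m)
  show ?case
  proof (rule map_core_step[OF _ _ Suc.prems])
    show "map_atom (\<gamma> (Suc m)) A \<in> F" if "A \<in> rule_db \<rho>" for A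
    proof -
      obtain B where B: "B \<in> set (body \<rho>)" "A = map_atom \<sigma>_uc B" using \<open>A \<in> rule_db \<rho>\<close> by (auto simp: rule_db_def)
      have "map_atom \<tau> B \<in> C" using loaded B(1) by (auto simp: loaded_def)
      then show ?thesis using Suc.IH[of "map_atom \<tau> B"] B(2) by (simp add: map_atom_map_atom \<gamma>_Suc)
    qed
    \<comment> \<open>The recurrent trigger fires under the current iterate and plays the role of
      the start trigger for the next copy.\<close>
    have "loaded F (\<rho>, \<lambda>x. \<gamma> m (\<tau> x))"
      using loaded Suc.IH by (intro loaded_map) (auto elim: loaded_subset)
    then show "out 0 (\<rho>, \<lambda>x. \<gamma> (Suc m) (\<sigma>_uc x)) \<subseteq> F"
      unfolding \<gamma>_Suc by (intro fires trig det loaded unblockable)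
  qed
qed

text \<open>The iterate numbered by the maximal rank \<open>?N\<close> in \<open>F\<close> takes a
  start term to rank \<open>?N + 1\<close>.\<close>

lemma infinite_F: "infinite F"
proof
  assume "finite F"
  let ?T = "\<Union>A\<in>F. set (args A)" and ?N = "Max (rank X ` (\<Union>A\<in>F. set (args A)))"
  have fin: "finite (rank X ` ?T)" using \<open>finite F\<close> by simp
  obtain y where y: "y \<in> ex_vars 0 \<rho>" by (rule ex_var)
  obtain A where A: "A \<in> out 0 (\<rho>, \<sigma>_uc)" "start_term \<rho> y \<in> set (args A)"
    using out_ex_term[OF y] by (auto simp: start_term_def)
  have "A \<in> C" using A(1) by (rule core.start)
  then have "map_atom (\<gamma> ?N) A \<in> F" and t: "start_term \<rho> y \<in> terms_of C"
    using A(2) by (auto intro: map_core args_in_terms_of)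
  then have "\<gamma> ?N (start_term \<rho> y) \<in> ?T" using A(2) by (fastforce simp: atom.map_sel)
  then have "rank X (\<gamma> ?N (start_term \<rho> y)) \<le> ?N" using fin by (intro Max_ge) auto
  then show False using t rank_\<gamma>_Fn[of _ _ ?N] by (simp add: start_term_def)
qed

end

section \<open>Finite chase trees\<close>

text \<open>\<open>P\<close> passes from parent to child, and a vertex of maximal length, which
  exists by finiteness, is a leaf and hence a model.\<close>

lemma finite_chase_tree_induct:
  assumes tree: "chase_tree R D V fct trg" "finite V" and init: "P D"
    and step: "\<And>F \<psi> \<tau> i. P F \<Longrightarrow> is_trigger R (\<psi>, \<tau>) \<Longrightarrow> loaded F (\<psi>, \<tau>) \<Longrightarrow> \<not> obsolete F (\<psi>, \<tau>) \<Longrightarrow>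
      i < branching \<psi> \<Longrightarrow> P (F \<union> out i (\<psi>, \<tau>))"
  obtains F where "P F" "\<And>\<rho>. \<rho> \<in> R \<Longrightarrow> satisfies F \<rho>"
proof -
  have root: "[] \<in> V" "fct [] = D" and closed: "\<And>v i. v @ [i] \<in> V \<Longrightarrow> v \<in> V"
    and inner: "\<And>v. v \<in> V \<Longrightarrow> \<not> is_leaf V v \<Longrightarrow> is_trigger R (trg v) \<and> loaded (fct v) (trg v) \<and>
        \<not> obsolete (fct v) (trg v) \<and> (\<forall>i. v @ [i] \<in> V \<longleftrightarrow> i < branching (fst (trg v))) \<and>
        (\<forall>i<branching (fst (trg v)). fct (v @ [i]) = fct v \<union> out i (trg v))"
    and leaf: "\<And>v. is_leaf V v \<Longrightarrow> \<forall>\<rho>\<in>R. satisfies (fct v) \<rho>"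
    using tree(1) unfolding chase_tree_def by blast+
  have P: "v \<in> V \<Longrightarrow> P (fct v)" for v
  proof (induction v rule: rev_induct)
    case Nil
    then show ?case using init root by simp
  next
    case (snoc i v)
    have v: "v \<in> V" "\<not> is_leaf V v" using snoc.prems closed by (auto simp: is_leaf_def)
    then show ?case using inner[OF v] snoc step[of "fct v" "fst (trg v)" "snd (trg v)" i] by auto
  qed
  obtain v where v: "v \<in> V" "\<And>w. w \<in> V \<Longrightarrow> length w \<le> length v"
  proof -
    have "finite (length ` V)" "length ` V \<noteq> {}" using tree(2) root by auto
    then have "Max (length ` V) \<in> length ` V" by (rule Max_in)
    then obtain v where "v \<in> V" "length v = Max (length ` V)" by (metis imageE)
    then show thesis using that[of v] tree(2) by simp
  qed
  then have "v @ [i] \<notin> V" for i by fastforce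
  then have "is_leaf V v" using v(1) by (simp add: is_leaf_def)
  then show thesis using that[OF P[OF v(1)]] leaf by blast
qed

section \<open>Replacing fresh constants by start terms\<close>

locale fresh_start = generating_rule
begin

text \<open>\<open>Cst y\<close> is fresh for the body, whose constants are all of the form
  \<open>VarCst x\<close>.\<close>

definition \<delta> :: subst where
  "\<delta> x = (if x \<in> ex_vars 0 \<rho> then Base (Cst x) else \<sigma>_uc x)"

definition D :: "fact set" where
  "D = map_atom \<delta> ` (set (body \<rho>) \<union> set (head 0 \<rho>))"

definition \<phi> :: "gterm \<Rightarrow> gterm" where
  "\<phi> = lift (\<lambda>c. case c of Cst y \<Rightarrow> if y \<in> ex_vars 0 \<rho> then start_term \<rho> y else Base c | _ \<Rightarrow> Base c)"

definition clean :: "gterm \<Rightarrow> bool" where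
  "clean t \<longleftrightarrow> (\<forall>y\<in>ex_vars 0 \<rho>. start_term \<rho> y \<notin> subterms t)"

lemma hom_\<phi>: "hom \<phi>"
  unfolding \<phi>_def by (rule hom_lift)

lemma \<phi>_Fn: "\<phi> (Fn f ts) = Fn f (map \<phi> ts)"
  using hom_\<phi> by (simp add: hom_def)

lemma \<phi>_\<delta>: "\<phi> (\<delta> x) = sk_val 0 \<rho> \<sigma>_uc x"
  by (simp add: \<phi>_def \<delta>_def sk_val_def start_term_def \<sigma>_uc_def)

lemma \<phi>_Base: "\<phi> (Base c) = Base c \<or> (\<exists>y\<in>ex_vars 0 \<rho>. c = Cst y \<and> \<phi> (Base c) = start_term \<rho> y)"
  by (auto simp: \<phi>_def split: const.splits)

lemma \<phi>_eq_\<sigma>_uc: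
  assumes "\<phi> t = \<sigma>_uc x"
  shows "t = \<sigma>_uc x"
proof (cases t)
  case (Base c)
  then show ?thesis using assms \<phi>_Base[of c] by (auto simp: \<sigma>_uc_def start_term_def)
next
  case (Fn f ts)
  then show ?thesis using assms by (simp add: \<phi>_Fn \<sigma>_uc_def)
qed

lemma \<phi>_eq_start:
  assumes "\<phi> (Fn f ts) = start_term \<rho> y"
  shows "Fn f ts = start_term \<rho> y"
proof -
  have f: "f = Sk \<rho> 0 y" and eq: "map \<phi> ts = map \<sigma>_uc (frontier \<rho>)"
    using assms by (auto simp: \<phi>_Fn start_term_def)
  have len: "length ts = length (frontier \<rho>)" using map_eq_imp_length_eq[OF eq] .
  have "ts = map \<sigma>_uc (frontier \<rho>)"
  proof (rule nth_equalityI)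
    fix n assume n: "n < length ts"
    have "\<phi> (ts ! n) = \<sigma>_uc (frontier \<rho> ! n)" using arg_cong[OF eq, of "\<lambda>xs. xs ! n"] n len by simp
    then show "ts ! n = map \<sigma>_uc (frontier \<rho>) ! n" using n len \<phi>_eq_\<sigma>_uc by simp
  qed (simp add: len)
  then show ?thesis using f by (simp add: start_term_def)
qed

lemma \<phi>_Base_Fn: "clean (Fn f ts) \<Longrightarrow> \<phi> (Base c) \<noteq> \<phi> (Fn f ts)"
  using \<phi>_Base[of c] \<phi>_eq_start[of f ts] subterms_refl[of "Fn f ts"]
  unfolding clean_def by (metis \<phi>_Fn trm.distinct(1))

text \<open>A fresh constant could be confused only with the start term that replaces it, and clean
  terms contain none.\<close>

lemma \<phi>_inj: "clean s \<Longrightarrow> clean t \<Longrightarrow> \<phi> s = \<phi> t \<Longrightarrow> s = t"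
proof (induction s arbitrary: t)
  case (Base c)
  then obtain d where t: "t = Base d" using \<phi>_Base_Fn by (cases t) auto
  then show ?case using Base \<phi>_Base[of c] \<phi>_Base[of d] by (auto simp: start_term_def)
next
  case (Fn f ss)
  obtain ts where t: "t = Fn f ts" using Fn \<phi>_Base_Fn[of f ss] by (cases t) (auto simp: \<phi>_Fn)
  have eq: "map \<phi> ss = map \<phi> ts" using Fn.prems(3) t by (simp add: \<phi>_Fn)
  then have len: "length ss = length ts" by (rule map_eq_imp_length_eq)
  have arg: "clean u" if "clean (Fn f us)" "u \<in> set us" for u us
    using that by (auto simp: clean_def)
  have "ss = ts"
  proof (rule nth_equalityI[OF len])
    fix n assume n: "n < length ss"
    have eq_n: "\<phi> (ss ! n) = \<phi> (ts ! n)" using arg_cong[OF eq, of "\<lambda>xs. xs ! n"] n len by simp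
    have "ss ! n \<in> set ss" "ts ! n \<in> set ts" using n len by auto
    then show "ss ! n = ts ! n"
      using Fn.IH[OF _ arg[OF Fn.prems(1)] arg[OF Fn.prems(2)[unfolded t]] eq_n] by blast
  qed
  then show ?case using t by simp
qed

lemma database_D: "database D"
proof -
  have b: "0 < branching \<rho>" using branching_1 by simp
  have "wf_rule \<rho>" using wf rule by blast
  then have "wf_atom A" if "A \<in> set (body \<rho>) \<union> set (head 0 \<rho>)" for A
    using that head_wf[OF _ b, of A] by (auto simp: wf_rule_def)
  then show ?thesis
    by (auto simp: database_def D_def atom.map_sel \<delta>_def \<sigma>_uc_def)
qed

text \<open>After renaming, the database is the result of applying the start trigger, so renamed
  chase branches are derivations from \<open>rule_db \<rho>\<close>.\<close>

lemma \<phi>_D: "map_atom \<phi> ` D = rule_db \<rho> \<union> out 0 (\<rho>, \<sigma>_uc)"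
proof -
  have "map_atom (sk_val 0 \<rho> \<sigma>_uc) ` set (body \<rho>) = rule_db \<rho>"
    unfolding rule_db_def
    by (rule image_map_atom_cong) (auto simp: sk_val_def ex_vars_def dest: body_varsI)
  then show ?thesis by (simp add: D_def image_Un image_image map_atom_map_atom \<phi>_\<delta> out_eq)
qed

lemma start_trigger: "is_trigger R (\<rho>, \<sigma>_uc)" "loaded (rule_db \<rho>) (\<rho>, \<sigma>_uc)"
  using rule by (auto simp: is_trigger_def loaded_def rule_db_def \<sigma>_uc_def intro: sk_terms.intros)

definition chase_invariant :: "fact set \<Rightarrow> bool" where
  "chase_invariant F \<longleftrightarrow> finite F \<and> D \<subseteq> F \<and> (\<forall>t\<in>terms_of F. clean t) \<and> deriv R (rule_db \<rho>) (map_atom \<phi> ` F)"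

lemma chase_invariant_D: "chase_invariant D"
proof -
  have "0 < branching \<rho>" using branching_1 by simp
  then have "deriv R (rule_db \<rho>) (map_atom \<phi> ` D)"
    unfolding \<phi>_D by (intro deriv.intros start_trigger)
  moreover have "clean t" if "t \<in> terms_of D" for t
    using that database_D by (fastforce simp: database_def terms_of_def clean_def start_term_def)
  ultimately show ?thesis using database_D by (simp add: chase_invariant_def database_def)
qed

lemma \<phi>_sk_terms: "t \<in> sk_terms R \<Longrightarrow> \<phi> t \<in> sk_terms R"
proof (induction rule: sk_terms.induct)
  case (1 c)
  have "start_term \<rho> y \<in> sk_terms R" if "y \<in> ex_vars 0 \<rho>" for y
    unfolding start_term_def using that rule branching_1
    by (intro sk_terms.intros) (auto simp: sk_funs_def \<sigma>_uc_def intro: sk_terms.intros)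
  then show ?case using \<phi>_Base[of c] by (auto intro: sk_terms.intros)
next
  case (2 \<psi> i y ts)
  then show ?case unfolding \<phi>_Fn by (intro sk_terms.intros) auto
qed

text \<open>The instance of the head under \<delta> is part of the database and witnesses
  obsoleteness.\<close>

lemma obsolete_start:
  assumes "D \<subseteq> F" "\<And>x. x \<in> set (frontier \<rho>) \<Longrightarrow> \<tau> x = \<sigma>_uc x"
  shows "obsolete F (\<rho>, \<tau>)"
proof -
  let ?\<sigma> = "\<lambda>x. if x \<in> body_vars \<rho> then \<tau> x else \<delta> x"
  have b: "0 < branching \<rho>" using branching_1 by simp
  have "map_atom ?\<sigma> A \<in> F" if A: "A \<in> set (head 0 \<rho>)" for A
  proof -
    have "map_atom ?\<sigma> A = map_atom \<delta> A"
    proof (rule map_atom_cong)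
      fix x assume "x \<in> set (args A)"
      from head_var_cases[OF b A this] show "?\<sigma> x = \<delta> x"
        using assms(2) by (auto simp: \<delta>_def ex_vars_def)
    qed
    then show ?thesis using A assms(1) by (auto simp: D_def)
  qed
  then show ?thesis using b by (auto simp: obsolete_def intro!: exI[of _ 0] exI[of _ ?\<sigma>])
qed

lemma chase_invariant_step:
  assumes F: "chase_invariant F" and trig: "is_trigger R (\<psi>, \<tau>)" and loaded: "loaded F (\<psi>, \<tau>)"
    and nob: "\<not> obsolete F (\<psi>, \<tau>)" and i: "i < branching \<psi>"
  shows "chase_invariant (F \<union> out i (\<psi>, \<tau>))"
proof -
  have "is_trigger R (\<psi>, \<lambda>x. \<phi> (\<tau> x))" using trig \<phi>_sk_terms by (auto simp: is_trigger_def)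
  moreover have "loaded (map_atom \<phi> ` F) (\<psi>, \<lambda>x. \<phi> (\<tau> x))"
    using loaded by (auto simp: loaded_def map_atom_map_atom[symmetric])
  ultimately have "deriv R (rule_db \<rho>) (map_atom \<phi> ` (F \<union> out i (\<psi>, \<tau>)))"
    using F i unfolding image_Un hom_out[OF hom_\<phi>] chase_invariant_def by (intro deriv.step) auto
  moreover have "clean t" if A: "A \<in> out i (\<psi>, \<tau>)" and t: "t \<in> set (args A)" for A t
  proof -
    have fr: "clean (\<tau> x)" if "x \<in> set (frontier \<psi>)" for x
      using F loaded that by (auto simp: chase_invariant_def intro: loaded_terms frontier_body)
    from i A t show ?thesis
    proof (cases rule: out_args_cases)
      case (Ex v)
      \<comment> \<open>Only a \<rho>-trigger that agrees with \<open>\<sigma>_uc\<close> on the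
        frontier could create a start term, and it is obsolete.\<close>
      have "start_term \<rho> y \<noteq> t" for y
      proof
        assume "start_term \<rho> y = t"
        then have "\<psi> = \<rho>" "map \<tau> (frontier \<rho>) = map \<sigma>_uc (frontier \<rho>)" by (auto simp: start_term_def Ex(2))
        then have "obsolete F (\<psi>, \<tau>)" using F obsolete_start by (auto simp: chase_invariant_def)
        then show False using nob by contradiction
      qed
      then show ?thesis using fr unfolding clean_def Ex(2) by auto
    qed (simp add: fr)
  qed
  then have "\<forall>t\<in>terms_of (out i (\<psi>, \<tau>)). clean t"
    by (auto simp: terms_of_def clean_def dest: subterms_trans)
  ultimately show ?thesis using F finite_out by (auto simp: chase_invariant_def terms_of_def)
qed

text \<open>Injectivity on clean terms lets a loaded trigger be pulled back to \<open>F\<close>; its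
  witness there is renamed again.\<close>

lemma satisfies_\<phi>:
  assumes clean: "\<forall>t\<in>terms_of F. clean t" and sat: "satisfies F \<psi>"
  shows "satisfies (map_atom \<phi> ` F) \<psi>"
  unfolding satisfies_def
proof (intro allI impI)
  fix \<tau> assume loaded: "loaded (map_atom \<phi> ` F) (\<psi>, \<tau>)"
  have inj: "inj_on \<phi> (terms_of F)" using clean by (auto intro!: inj_onI \<phi>_inj)
  let ?k = "pull \<phi> (terms_of F)"
  have k: "?k (\<phi> t) = t" if "A \<in> F" "t \<in> set (args A)" for A t
    using inj args_in_terms_of[OF that] by (rule pull_image)
  have kA: "map_atom ?k (map_atom \<phi> A) = A" if "A \<in> F" for A
    unfolding map_atom_map_atom using map_atom_cong[of A "\<lambda>t. ?k (\<phi> t)" "\<lambda>t. t"] k[OF that]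
    by (simp add: atom.map_ident)
  have "loaded F (\<psi>, \<lambda>x. ?k (\<tau> x))"
    using loaded kA by (fastforce simp: loaded_def map_atom_map_atom[symmetric])
  then have "obsolete F (\<psi>, \<lambda>x. ?k (\<tau> x))" using sat by (simp add: satisfies_def)
  then obtain i \<sigma> where i: "i < branching \<psi>" and \<sigma>: "\<And>x. x \<in> body_vars \<psi> \<Longrightarrow> \<sigma> x = ?k (\<tau> x)"
    and head: "map_atom \<sigma> ` set (head i \<psi>) \<subseteq> F"
    by (auto simp: obsolete_def)
  have "\<phi> (\<sigma> x) = \<tau> x" if x: "x \<in> body_vars \<psi>" for x
  proof -
    obtain A where A: "A \<in> set (body \<psi>)" "x \<in> set (args A)" using body_var_in_body[OF x] by blast
    then obtain B where B: "B \<in> F" "map_atom \<tau> A = map_atom \<phi> B" using loaded by (auto simp: loaded_def)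
    have "\<tau> x \<in> set (args (map_atom \<tau> A))" using A(2) by (simp add: atom.map_sel)
    then obtain t where "t \<in> set (args B)" "\<tau> x = \<phi> t" unfolding B(2) by (auto simp: atom.map_sel)
    then show ?thesis using \<sigma>[OF x] k[OF B(1)] by simp
  qed
  moreover have "map_atom (\<lambda>x. \<phi> (\<sigma> x)) ` set (head i \<psi>) \<subseteq> map_atom \<phi> ` F"
    using head by (auto simp: map_atom_map_atom[symmetric])
  ultimately show "obsolete (map_atom \<phi> ` F) (\<psi>, \<tau>)"
    using i unfolding obsolete_def by (auto intro!: exI[of _ i] exI[of _ "\<lambda>x. \<phi> (\<sigma> x)"])
qed

lemma finite_model:
  assumes "chase_tree R D V fct trg" "finite V"
  obtains F where "finite F" "deriv R (rule_db \<rho>) F" "out 0 (\<rho>, \<sigma>_uc) \<subseteq> F"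
    "\<And>\<psi>. \<psi> \<in> R \<Longrightarrow> satisfies F \<psi>"
proof -
  obtain F where F: "chase_invariant F" and sat: "\<And>\<psi>. \<psi> \<in> R \<Longrightarrow> satisfies F \<psi>"
    using finite_chase_tree_induct[of R D V fct trg chase_invariant] assms chase_invariant_D chase_invariant_step by blast
  have "out 0 (\<rho>, \<sigma>_uc) \<subseteq> map_atom \<phi> ` D" by (simp add: \<phi>_D)
  also have "\<dots> \<subseteq> map_atom \<phi> ` F" using F by (auto simp: chase_invariant_def)
  finally show thesis using that[of "map_atom \<phi> ` F"] F sat satisfies_\<phi> by (auto simp: chase_invariant_def)
qed

end

theorem theorem6:
  fixes R :: "rule set"
  assumes "\<forall>\<rho>\<in>R. wf_rule \<rho>"
    and "DRPC R"
  shows "never_terminates R"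
proof -
  obtain \<rho> t where \<rho>: "\<rho> \<in> R" "deterministic \<rho>" "generating \<rho>"
    and t: "t \<in> terms_of (DRPC_facts R \<rho>)" "rule_cyclic \<rho> t"
    using assms(2) by (auto simp: DRPC_def)
  interpret fresh_start R \<rho> by unfold_locales (use assms(1) \<rho> in auto)
  obtain \<tau> where \<tau>: "is_trigger R (\<rho>, \<tau>)" "loaded C (\<rho>, \<tau>)" "star_unblockable R (\<rho>, \<tau>)"
    "inj_on \<tau> (body_vars \<rho>)"
    using recurrent_trigger[OF t] .
  have "\<not> (chase_tree R D V fct trg \<and> finite V)" for V fct trg
  proof
    assume "chase_tree R D V fct trg \<and> finite V"
    then obtain F where F: "finite F" "deriv R (rule_db \<rho>) F" "out 0 (\<rho>, \<sigma>_uc) \<subseteq> F"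
      "\<And>\<psi>. \<psi> \<in> R \<Longrightarrow> satisfies F \<psi>"
      using finite_model by blast
    interpret recurrence R \<rho> \<tau> F by unfold_locales (use \<tau> F in auto)
    show False using infinite_F F(1) by contradiction
  qed
  then show ?thesis using database_D by (auto simp: never_terminates_def)
qed

end
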